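(* Let $T$ be a measure-preserving mixing (or mildly mixing) transformation on a probability space $(X,\mu)$ with metric $d_X$, and suppose that $T$ is restricted sensitive. Let $S$ be a type III nonsingular conservative ergodic invertible transformation on a probability space $(Y,\nu)$ with metric $d_Y$. Then $T\times S$ on $X\times Y$ (with the product $\sigma$-algebra and product measure $\mu\times\nu$), with the metric $$d((x_1,y_1),(x_2,y_2))=\max\{d_X(x_1,x_2),d_Y(y_1,y_2)\},$$ is a type III conservative ergodic transformation that is restricted sensitive.
   Context: All probability spaces are standard, and all metrics are assumed measurable, so that balls are measurable. A measurable transformation $R$ of $(Z,m)$ is nonsingular if, for measurable $A$, $m(R^{-1}A)=0$ if and only if $m(A)=0$. It is conservative if for every measurable $A$ with $m(A)>0$ there is $n\ge 1$ with $m(A\cap R^{-n}A)>0$, and ergodic if every measurable $A$ with $R^{-1}A=A$ is null or has null complement. A nonsingular transformation of $(Z,m)$ is type III if there is no $\sigma$-finite measure that is invariant under the transformation and equivalent to $m$. A measure-preserving transformation $T$ of a probability space $(X,\mu)$ is mixing if $\mu(T^{-n}A\cap B)\to\mu(A)\mu(B)$ as $n\to\infty$ for all measurable $A,B$, and mildly mixing if $\liminf_{n\to\infty}\mu(T^{-n}A\,\triangle\,A)>0$ for every measurable $A$ with $0<\mu(A)<1$. Restricted sensitivity: a measurable nonsingular transformation $R$ of a probability space $(Z,m)$ equipped with a metric $\rho$ is restricted sensitive if for $m$-a.e. $z\in Z$ there exist $\delta>0$ and $a>0$ such that for every $\varepsilon>0$ there exists an integer $n\ge 0$ with $n\le -a\log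 m(B_\varepsilon(z))$ and $m\{w\in B_\varepsilon(z):\rho(R^nz,R^nw)>\delta\}>0$. Here $B_\varepsilon(z)$ is the open $\rho$-ball of radius $\varepsilon$ about $z$.
   Formalization: It is additionally assumed that for almost every y in Y all balls around y have positive measure; without this the claim fails, for instance for the discrete metric on Y, and restricted sensitivity of T×S forces it. *)

theory Defs
  imports "HOL-Probability.Probability"
begin

text \<open>
  The measurable sets of a standard probability space are the Borel sets of a Polish topology on
  the space, possibly enlarged by null sets.  This covers standard Borel probability spaces as
  well as their completions.
\<close>

definition standard_prob_space :: "'a measure \<Rightarrow> bool" where
  "standard_prob_space M \<longleftrightarrow> prob_space M \<and>
     (\<exists>X. topspace X = space M \<and> completely_metrizable_space X \<and> second_countable X \<and>
        sigma_sets (space M) {U. openin X U} \<subseteq> sets M \<and>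
        (\<forall>A\<in>sets M. \<exists>B\<in>sigma_sets (space M) {U. openin X U}.
           \<exists>C\<in>sigma_sets (space M) {U. openin X U}.
             B \<subseteq> A \<and> A \<subseteq> C \<and> emeasure M (C - B) = 0))"

definition measurable_metric :: "'a measure \<Rightarrow> ('a \<Rightarrow> 'a \<Rightarrow> real) \<Rightarrow> bool" where
  "measurable_metric M d \<longleftrightarrow>
     Metric_space (space M) d \<and> (\<lambda>(x, y). d x y) \<in> borel_measurable (M \<Otimes>\<^sub>M M)"

text \<open>
  Almost every point has only balls of positive measure.  This does not follow from
  measurability of the metric: the discrete metric on a non-atomic standard Borel probability
  space is measurable, but its small balls are null.
\<close>

definition ae_positive_balls :: "'a measure \<Rightarrow> ('a \<Rightarrow> 'a \<Rightarrow> real) \<Rightarrow> bool" where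
  "ae_positive_balls M d \<longleftrightarrow>
     (AE z in M. \<forall>\<epsilon>>0. measure M (Metric_space.mball (space M) d z \<epsilon>) > 0)"

definition nonsingular :: "'a measure \<Rightarrow> ('a \<Rightarrow> 'a) \<Rightarrow> bool" where
  "nonsingular M R \<longleftrightarrow> R \<in> measurable M M \<and>
     (\<forall>A\<in>sets M. emeasure M (R -` A \<inter> space M) = 0 \<longleftrightarrow> emeasure M A = 0)"

definition conservative :: "'a measure \<Rightarrow> ('a \<Rightarrow> 'a) \<Rightarrow> bool" where
  "conservative M R \<longleftrightarrow>
     (\<forall>A\<in>sets M. emeasure M A > 0 \<longrightarrow>
        (\<exists>n\<ge>1. emeasure M (A \<inter> ((R ^^ n) -` A \<inter> space M)) > 0))"

definition ergodic :: "'a measure \<Rightarrow> ('a \<Rightarrow> 'a) \<Rightarrow> bool" where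
  "ergodic M R \<longleftrightarrow>
     (\<forall>A\<in>sets M. R -` A \<inter> space M = A \<longrightarrow>
        emeasure M A = 0 \<or> emeasure M (space M - A) = 0)"

definition invertible_transformation :: "'a measure \<Rightarrow> ('a \<Rightarrow> 'a) \<Rightarrow> bool" where
  "invertible_transformation M R \<longleftrightarrow> R \<in> measurable M M \<and>
     (\<exists>R'\<in>measurable M M. \<forall>x\<in>space M. R' (R x) = x \<and> R (R' x) = x)"

definition measure_preserving :: "'a measure \<Rightarrow> ('a \<Rightarrow> 'a) \<Rightarrow> bool" where
  "measure_preserving M R \<longleftrightarrow> R \<in> measurable M M \<and>
     (\<forall>A\<in>sets M. emeasure M (R -` A \<inter> space M) = emeasure M A)"

definition type_III :: "'a measure \<Rightarrow> ('a \<Rightarrow> 'a) \<Rightarrow> bool" where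
  "type_III M R \<longleftrightarrow> nonsingular M R \<and>
     \<not> (\<exists>\<eta>. sets \<eta> = sets M \<and> sigma_finite_measure \<eta> \<and>
            absolutely_continuous M \<eta> \<and> absolutely_continuous \<eta> M \<and> measure_preserving \<eta> R)"

definition mixing :: "'a measure \<Rightarrow> ('a \<Rightarrow> 'a) \<Rightarrow> bool" where
  "mixing M T \<longleftrightarrow>
     (\<forall>A\<in>sets M. \<forall>B\<in>sets M.
        (\<lambda>n. measure M (((T ^^ n) -` A \<inter> space M) \<inter> B)) \<longlonglongrightarrow> measure M A * measure M B)"

definition mildly_mixing :: "'a measure \<Rightarrow> ('a \<Rightarrow> 'a) \<Rightarrow> bool" where
  "mildly_mixing M T \<longleftrightarrow>
     (\<forall>A\<in>sets M. 0 < emeasure M A \<and> emeasure M A < 1 \<longrightarrow>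
        0 < liminf (\<lambda>n. emeasure M (sym_diff ((T ^^ n) -` A \<inter> space M) A)))"

text \<open>
  In the definition below no convention for the logarithm of 0 is needed: if a ball is null, the
  last inequality fails for it.
\<close>

definition restricted_sensitive ::
    "'a measure \<Rightarrow> ('a \<Rightarrow> 'a \<Rightarrow> real) \<Rightarrow> ('a \<Rightarrow> 'a) \<Rightarrow> bool" where
  "restricted_sensitive M d R \<longleftrightarrow>
     prob_space M \<and> measurable_metric M d \<and> nonsingular M R \<and>
     (AE z in M. \<exists>\<delta>>0. \<exists>a>0. \<forall>\<epsilon>>0. \<exists>n::nat.
        real n \<le> - a * ln (measure M (Metric_space.mball (space M) d z \<epsilon>)) \<and>
        measure M {w \<in> Metric_space.mball (space M) d z \<epsilon>. d ((R ^^ n) z) ((R ^^ n) w) > \<delta>} > 0)"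

end

theory Submission
  imports Defs
begin

text \<open>
  Write \<open>\<mu>\<close> and \<open>\<nu>\<close> for the two measures, \<open>R = T \<times> S\<close>, and \<open>A\<^sub>y = {x. (x, y) \<in> A}\<close>
  for the slices of a set \<open>A\<close> in the product. Since \<open>T\<close> preserves \<open>\<mu>\<close>, the slice of
  \<open>R\<^sup>-\<^sup>n A\<close> at \<open>y\<close> is the preimage under \<open>T\<^sup>n\<close> of the slice of \<open>A\<close> at \<open>S\<^sup>n y\<close> and has the
  same measure as that slice. Conservativity and ergodicity of \<open>R\<close> are read off from the
  slices along the \<open>S\<close>-orbit of a point \<open>y\<close>, and the main input from \<open>S\<close> is that almost every point of a measurable
  set returns to it infinitely often.

  Conservativity: if \<open>W\<close> is wandering for \<open>R\<close>, then the preimages under \<open>T\<^sup>n\<close> of the slices of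
  \<open>W\<close> at \<open>S\<^sup>n y\<close> are disjoint, so the measures of these slices have a finite sum. If \<open>W\<close> were
  not null, recurrence (\<open>conservative_recurrence\<close>) would make infinitely many of
  them larger than a fixed positive number.

  Ergodicity: the slices of a fixed product set lie in the closure of a countable family
  (\<open>sets_pair_countable_dense_slices\<close>), so by recurrence, for almost every \<open>y\<close>, \<open>A\<^sub>y\<close> is
  approximated arbitrarily well by the slices at the points \<open>S\<^sup>n y\<close>, for infinitely many \<open>n\<close>. If \<open>A\<close> is invariant, then \<open>A\<^sub>y\<close> is the preimage under \<open>T\<^sup>n\<close> of the slice
  at \<open>S\<^sup>n y\<close>; so \<open>A\<^sub>y\<close> is rigid along these \<open>n\<close>, and mild mixing makes it trivial. The points
  with full slices form an \<open>S\<close>-invariant set, to which the ergodicity of \<open>S\<close> applies. Mixing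
  implies mild mixing.

  Type III: let \<open>\<eta> = f (\<mu> \<times> \<nu>)\<close> be \<open>\<sigma>\<close>-finite, equivalent to the product measure and
  \<open>R\<close>-invariant. Integrating \<open>f\<close> over \<open>x\<close> would give an \<open>S\<close>-invariant measure on the second
  factor, but the integral may be infinite. It is replaced by the number \<open>q y\<close> that is the
  largest \<open>a\<close> for which the integral of \<open>min (f (\<cdot>, y)) a\<close> is at least \<open>a / 2\<close>. It is
  positive and finite for almost every \<open>y\<close> and scales linearly with \<open>f\<close>. If \<open>T\<close> is invertible,
  \<open>T\<close> carries the density on one fibre to a multiple of the density on the next, and \<open>q \<nu>\<close> is
  invariant. In general the density on the next fibre is only a conditional expectation of this
  multiple, which by concavity of \<open>min\<close> can only increase \<open>q\<close>; so the measure of a preimage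
  under \<open>q \<nu>\<close> is at most that of the set. For a conservative transformation such a measure is
  invariant (\<open>conservative_subinvariant_imp_measure_preserving\<close>), and it
  contradicts the type of \<open>S\<close>.

  Restricted sensitivity: balls of the maximum metric are products of balls, and the second
  factor can only decrease the measure of the ball. The time \<open>n\<close> that works for \<open>T\<close> therefore
  works for \<open>R\<close>.
\<close>

section \<open>Iterates and recurrence\<close>

lemma nonsingular_measurable: "nonsingular M R \<Longrightarrow> R \<in> measurable M M"
  by (simp add: nonsingular_def)

lemma nonsingular_AE:
  assumes R: "nonsingular M R" and P: "AE z in M. P z"
  shows "AE z in M. P (R z)"
proof -
  obtain E where E: "{z \<in> space M. \<not> P z} \<subseteq> E" "emeasure M E = 0" "E \<in> sets M"
    using AE_E[OF P] by metis
  have "R -` E \<inter> space M \<in> null_sets M"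
    using R E unfolding nonsingular_def by (auto)
  then have "AE z in M. z \<notin> R -` E \<inter> space M" by (rule AE_not_in)
  then show ?thesis
    using AE_space
  proof eventually_elim
    case (elim z)
    then show ?case using E(1) measurable_space[OF nonsingular_measurable[OF R]] by auto
  qed
qed

lemma nonsingular_AE_funpow:
  assumes "nonsingular M R" and "AE z in M. P z"
  shows "AE z in M. \<forall>n. P ((R ^^ n) z)"
proof -
  have "AE z in M. P ((R ^^ n) z)" for n
  proof (induction n)
    case (Suc n)
    from nonsingular_AE[OF assms(1) Suc] show ?case by (simp add: funpow_swap1)
  qed (use assms in simp)
  then show ?thesis by (simp add: AE_all_countable)
qed

text \<open>
  The points of \<open>B\<close> that never return to \<open>B\<close> form a set disjoint from all its preimages, hence
  a null set. By nonsingularity almost every orbit avoids this set at all times, so each visit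
  to \<open>B\<close> is followed by another.
\<close>

lemma conservative_recurrence:
  assumes R: "nonsingular M R" and c: "conservative M R" and B: "B \<in> sets M"
  shows "AE z in M. z \<in> B \<longrightarrow> (\<exists>\<^sub>\<infinity>n. (R ^^ n) z \<in> B)"
proof -
  note [measurable] = nonsingular_measurable[OF R] B
  define W where "W = B - (\<Union>n\<in>{1..}. (R ^^ n) -` B \<inter> space M)"
  have [measurable]: "W \<in> sets M" unfolding W_def by measurable
  have "W \<inter> ((R ^^ n) -` W \<inter> space M) = {}" if "n \<ge> 1" for n
    using that by (auto simp: W_def)
  then have "\<not> emeasure M W > 0"
    using c \<open>W \<in> sets M\<close> unfolding conservative_def by (metis emeasure_empty less_irrefl)
  then have "AE z in M. z \<notin> W" by (intro AE_not_in) (auto)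
  from nonsingular_AE_funpow[OF R this] show ?thesis
    using AE_space
  proof eventually_elim
    case (elim z)
    have ret: "\<exists>m\<ge>1. (R ^^ (m + n)) z \<in> B" if "(R ^^ n) z \<in> B" for n
      using elim(1)[rule_format, of n] that sets.sets_into_space[OF B]
      by (auto simp: W_def funpow_add)
    have "\<exists>n>m. (R ^^ n) z \<in> B" if "z \<in> B" for m
    proof (induction m)
      case 0
      from ret[of 0] that obtain k where "k \<ge> 1" "(R ^^ (k + 0)) z \<in> B" by auto
      then show ?case by (intro exI[of _ k]) simp
    next
      case (Suc m)
      then obtain n where "n > m" "(R ^^ n) z \<in> B" by blast
      with ret[of n] obtain k where "k \<ge> 1" "(R ^^ (k + n)) z \<in> B" by blast
      with \<open>n > m\<close> show ?case by (intro exI[of _ "k + n"]) simp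
    qed
    then show ?case by (simp add: INFM_nat)
  qed
qed

text \<open>
  Removing from a set without positive recurrence the null set of its returning points leaves a
  set that is exactly, not only almost, disjoint from its preimages.
\<close>

lemma conservativeI_wandering:
  assumes R[measurable]: "R \<in> measurable M M"
    and W: "\<And>W. W \<in> sets M \<Longrightarrow> (\<And>n. n \<ge> 1 \<Longrightarrow> W \<inter> ((R ^^ n) -` W \<inter> space M) = {}) \<Longrightarrow>
      emeasure M W = 0"
  shows "conservative M R"
  unfolding conservative_def
proof (intro ballI impI)
  fix A assume A[measurable]: "A \<in> sets M" and pos: "emeasure M A > 0"
  show "\<exists>n\<ge>1. emeasure M (A \<inter> ((R ^^ n) -` A \<inter> space M)) > 0"
  proof (rule ccontr)
    assume "\<not> ?thesis"
    then have z: "emeasure M (A \<inter> ((R ^^ n) -` A \<inter> space M)) = 0" if "n \<ge> 1" for n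
      using that by auto
    define E where "E = (\<Union>n\<in>{1..}. A \<inter> ((R ^^ n) -` A \<inter> space M))"
    have E: "E \<in> null_sets M"
      unfolding E_def using z by (intro null_sets_UN') (auto)
    have "emeasure M (A - E) = 0"
      by (rule W) (use E in \<open>auto simp: E_def\<close>)
    then show False using emeasure_Diff_null_set[OF E A] pos by simp
  qed
qed

lemma suminf_top_if_frequently_ge:
  fixes f :: "nat \<Rightarrow> ennreal"
  assumes "\<exists>\<^sub>\<infinity>n. c \<le> f n" and "0 < c"
  shows "(\<Sum>n. f n) = \<top>"
proof -
  define I where "I = {n. c \<le> f n}"
  have "infinite I" using assms(1) by (simp add: I_def INFM_iff_infinite)
  then have "\<top> = c * emeasure (count_space UNIV) I"
    using assms(2) by (simp add: ennreal_mult_eq_top_iff)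
  also have "\<dots> = (\<integral>\<^sup>+n. c * indicator I n \<partial>count_space UNIV)"
    by (simp add: nn_integral_cmult_indicator)
  also have "\<dots> \<le> (\<integral>\<^sup>+n. f n \<partial>count_space UNIV)"
    by (intro nn_integral_mono) (auto simp: I_def indicator_def)
  also have "\<dots> = (\<Sum>n. f n)" by (rule nn_integral_count_space_nat)
  finally have "\<top> \<le> (\<Sum>n. f n)" .
  then show ?thesis by (simp only: top_unique)
qed

lemma ennreal_ex_inverse_le:
  fixes x :: ennreal
  assumes "0 < x"
  shows "\<exists>k. inverse (of_nat (Suc k)) \<le> x"
proof (cases x)
  case (real r)
  then obtain n where "inverse (real (Suc n)) < r" using assms reals_Archimedean[of r] by auto
  then have "ennreal (inverse (real (Suc n))) \<le> x" using real by (simp add: ennreal_leI)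
  then show ?thesis
    by (intro exI[of _ n]) (simp only: ennreal_of_nat_eq_real_of_nat inverse_ennreal of_nat_0_less_iff zero_less_Suc)
qed simp

section \<open>Slices of product sets\<close>

abbreviation slice :: "('a \<times> 'b) set \<Rightarrow> 'b \<Rightarrow> 'a set" where
  "slice C y \<equiv> (\<lambda>x. (x, y)) -` C"

lemma measure_preserving_emeasure_funpow:
  assumes T: "measure_preserving M T" and A: "A \<in> sets M"
  shows "emeasure M ((T ^^ n) -` A \<inter> space M) = emeasure M A"
proof (induction n)
  case 0
  then show ?case using sets.Int_space_eq2[OF A] by simp
next
  case (Suc n)
  note [measurable] = A
  have [measurable]: "T \<in> measurable M M" using T by (simp add: measure_preserving_def)
  have "(\<lambda>x. (T ^^ Suc n) x) -` A \<inter> space M = T -` ((T ^^ n) -` A \<inter> space M) \<inter> space M"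
    using measurable_space[OF \<open>T \<in> measurable M M\<close>] by (auto simp: funpow_swap1)
  also have "emeasure M \<dots> = emeasure M ((T ^^ n) -` A \<inter> space M)"
    using T unfolding measure_preserving_def by (metis measurable_sets A \<open>T \<in> measurable M M\<close> measurable_compose_n)
  finally show ?case using Suc by (simp only:)
qed

lemma map_prod_funpow:
  fixes T :: "'a \<Rightarrow> 'a" and S :: "'b \<Rightarrow> 'b"
  shows "map_prod T S ^^ n = map_prod (T ^^ n) (S ^^ n)"
  by (induction n) (auto simp: map_prod.id)

lemma slice_vimage_map_prod:
  fixes T :: "'a \<Rightarrow> 'a" and S :: "'b \<Rightarrow> 'b"
  assumes "y \<in> space N"
  shows "slice ((map_prod T S ^^ n) -` C \<inter> space (M \<Otimes>\<^sub>M N)) y =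
    (T ^^ n) -` slice C ((S ^^ n) y) \<inter> space M"
  using assms by (auto simp: map_prod_funpow space_pair_measure)

lemma map_prod_measurable:
  "T \<in> measurable M M \<Longrightarrow> S \<in> measurable N N \<Longrightarrow>
    map_prod T S \<in> measurable (M \<Otimes>\<^sub>M N) (M \<Otimes>\<^sub>M N)"
  unfolding map_prod_def split_beta' by (intro measurable_Pair) (auto intro: measurable_compose[rotated])

lemma (in pair_sigma_finite) emeasure_eq_0_iff_AE_slice:
  assumes [measurable]: "C \<in> sets (M1 \<Otimes>\<^sub>M M2)"
  shows "emeasure (M1 \<Otimes>\<^sub>M M2) C = 0 \<longleftrightarrow> (AE y in M2. emeasure M1 (slice C y) = 0)"
  unfolding emeasure_pair_measure_alt2[OF assms]
  by (rule nn_integral_0_iff_AE) (rule measurable_emeasure_Pair2[OF assms])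

lemma nonsingular_map_prod:
  assumes "pair_sigma_finite M N"
    and T: "measure_preserving M T" and S: "nonsingular N S"
  shows "nonsingular (M \<Otimes>\<^sub>M N) (map_prod T S)"
  unfolding nonsingular_def
proof (intro conjI ballI)
  interpret pair_sigma_finite M N by fact
  note [measurable] = nonsingular_measurable[OF S]
  have [measurable]: "T \<in> measurable M M" using T by (simp add: measure_preserving_def)
  show R[measurable]: "map_prod T S \<in> measurable (M \<Otimes>\<^sub>M N) (M \<Otimes>\<^sub>M N)"
    by (rule map_prod_measurable) measurable
  fix C assume C[measurable]: "C \<in> sets (M \<Otimes>\<^sub>M N)"
  let ?P = "{y \<in> space N. emeasure M (slice C y) \<noteq> 0}"
  have P[measurable]: "?P \<in> sets N"
    using measurable_emeasure_Pair2[OF C] by measurable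
  have slice: "emeasure M (slice (map_prod T S -` C \<inter> space (M \<Otimes>\<^sub>M N)) y) = emeasure M (slice C (S y))"
    if "y \<in> space N" for y
    using slice_vimage_map_prod[OF that, where T=T and S=S and n=1 and C=C and M=M] measure_preserving_emeasure_funpow[OF T sets_Pair2[OF C], of 1]
    by simp
  have "emeasure (M \<Otimes>\<^sub>M N) (map_prod T S -` C \<inter> space (M \<Otimes>\<^sub>M N)) = 0
    \<longleftrightarrow> (AE y in N. emeasure M (slice C (S y)) = 0)"
    by (subst emeasure_eq_0_iff_AE_slice[OF measurable_sets[OF R C]]) (rule AE_cong, simp only: slice)
  also have "\<dots> \<longleftrightarrow> emeasure N (S -` ?P \<inter> space N) = 0"
  proof (rule AE_iff_measurable)
    show "S -` ?P \<inter> space N \<in> sets N" by (rule measurable_sets[OF nonsingular_measurable[OF S] P])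
    show "{y \<in> space N. emeasure M (slice C (S y)) \<noteq> 0} = S -` ?P \<inter> space N"
      using measurable_space[OF nonsingular_measurable[OF S]] by auto
  qed
  also have "\<dots> \<longleftrightarrow> emeasure N ?P = 0"
    using S P unfolding nonsingular_def by blast
  also have "\<dots> \<longleftrightarrow> emeasure (M \<Otimes>\<^sub>M N) C = 0"
    unfolding emeasure_eq_0_iff_AE_slice[OF C] by (subst AE_iff_measurable[OF P]) auto
  finally show "emeasure (M \<Otimes>\<^sub>M N) (map_prod T S -` C \<inter> space (M \<Otimes>\<^sub>M N)) = 0 \<longleftrightarrow>
    emeasure (M \<Otimes>\<^sub>M N) C = 0" .
qed

section \<open>Conservativity of the product\<close>

text \<open>
  The slices of the sets \<open>R\<^sup>-\<^sup>n W\<close> at a fixed \<open>y\<close> are disjoint in a space of total mass one, so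
  their measures are summable; recurrence of \<open>S\<close> to the set of points with a large slice forbids
  this unless almost every slice is null.
\<close>

theorem conservative_map_prod:
  assumes "prob_space M" and "sigma_finite_measure N"
    and T: "measure_preserving M T" and S: "nonsingular N S" and c: "conservative N S"
  shows "conservative (M \<Otimes>\<^sub>M N) (map_prod T S)"
proof (rule conservativeI_wandering)
  interpret M: prob_space M by fact
  interpret N: sigma_finite_measure N by fact
  interpret pair_sigma_finite M N ..
  have [measurable]: "T \<in> measurable M M" using T by (simp add: measure_preserving_def)
  note [measurable] = nonsingular_measurable[OF S]
  show R[measurable]: "map_prod T S \<in> measurable (M \<Otimes>\<^sub>M N) (M \<Otimes>\<^sub>M N)"
    by (rule map_prod_measurable) measurable
  fix W assume W[measurable]: "W \<in> sets (M \<Otimes>\<^sub>M N)"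
    and wand: "\<And>n. n \<ge> 1 \<Longrightarrow> W \<inter> ((map_prod T S ^^ n) -` W \<inter> space (M \<Otimes>\<^sub>M N)) = {}"
  let ?w = "\<lambda>y. emeasure M (slice W y)"
  have w[measurable]: "?w \<in> borel_measurable N" by (rule measurable_emeasure_Pair2[OF W])
  have "AE y in N. \<forall>k. y \<in> {y \<in> space N. inverse (of_nat (Suc k)) \<le> ?w y} \<longrightarrow>
    (\<exists>\<^sub>\<infinity>n. (S ^^ n) y \<in> {y \<in> space N. inverse (of_nat (Suc k)) \<le> ?w y})"
    unfolding AE_all_countable by (intro allI conservative_recurrence[OF S c]) measurable
  then have "AE y in N. ?w y = 0"
    using AE_space
  proof eventually_elim
    case (elim y)
    define E where "E n = (T ^^ n) -` slice W ((S ^^ n) y) \<inter> space M" for n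
    have [measurable]: "E n \<in> sets M" for n
      unfolding E_def using sets_Pair2[OF W] by measurable
    have disj: "E m \<inter> E n = {}" if "m < n" for m n
    proof -
      have False if "x \<in> E m" "x \<in> E n" for x
      proof -
        have y: "(S ^^ m) y \<in> space N" using elim(2) by (rule measurable_space[rotated]) measurable
        have x: "(T ^^ m) x \<in> space M"
          using \<open>x \<in> E m\<close> unfolding E_def by (intro measurable_space[of "T ^^ m" M M]) auto
        have "n = (n - m) + m" using \<open>m < n\<close> by simp
        then have "(T ^^ n) x = (T ^^ (n - m)) ((T ^^ m) x)" "(S ^^ n) y = (S ^^ (n - m)) ((S ^^ m) y)"
          by (metis funpow_add o_apply)+
        with that have "((T ^^ m) x, (S ^^ m) y) \<in> W \<inter> ((map_prod T S ^^ (n - m)) -` W \<inter> space (M \<Otimes>\<^sub>M N))"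
          using x y by (auto simp: E_def map_prod_funpow space_pair_measure)
        then show False using wand[of "n - m"] \<open>m < n\<close> by auto
      qed
      then show ?thesis by blast
    qed
    have "disjoint_family E"
      unfolding disjoint_family_on_def using disj by (metis inf_commute linorder_neqE_nat)
    then have "(\<Sum>n. emeasure M (E n)) = emeasure M (\<Union>n. E n)"
      by (intro suminf_emeasure) auto
    also have "\<dots> \<le> 1" using M.emeasure_le_1 .
    finally have "(\<Sum>n. emeasure M (E n)) \<noteq> \<top>" by (auto simp: top_unique)
    moreover have "emeasure M (E n) = ?w ((S ^^ n) y)" for n
      unfolding E_def by (rule measure_preserving_emeasure_funpow[OF T sets_Pair2[OF W]])
    ultimately have sum: "(\<Sum>n. ?w ((S ^^ n) y)) \<noteq> \<top>" by simp
    show ?case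
    proof (rule ccontr)
      assume "?w y \<noteq> 0"
      then obtain k where k: "inverse (of_nat (Suc k)) \<le> ?w y"
        using ennreal_ex_inverse_le[of "?w y"] by (metis not_gr_zero)
      with elim have "\<exists>\<^sub>\<infinity>n. inverse (of_nat (Suc k)) \<le> ?w ((S ^^ n) y)"
        by (auto elim: INFM_mono)
      then show False
        using suminf_top_if_frequently_ge[of "inverse (of_nat (Suc k))" "\<lambda>n. ?w ((S ^^ n) y)"] sum
        by (simp add: ennreal_inverse_positive)
    qed
  qed
  then show "emeasure (M \<Otimes>\<^sub>M N) W = 0" by (simp add: emeasure_eq_0_iff_AE_slice[OF W])
qed

section \<open>Ergodicity of the product\<close>

text \<open>
  Under mixing, the measure of the symmetric difference converges to
  \<open>2 \<mu>(A) (1 - \<mu>(A))\<close>, which is positive for a nontrivial set.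
\<close>

lemma (in prob_space) mixing_imp_mildly_mixing:
  assumes mp: "measure_preserving M T" and mix: "mixing M T"
  shows "mildly_mixing M T"
  unfolding mildly_mixing_def
proof (intro ballI impI)
  have [measurable]: "T \<in> measurable M M" using mp by (simp add: measure_preserving_def)
  fix A assume A[measurable]: "A \<in> sets M" and "0 < emeasure M A \<and> emeasure M A < 1"
  then have pos: "0 < prob A" "prob A < 1"
    by (auto simp: emeasure_eq_measure)
  let ?E = "\<lambda>n. (T ^^ n) -` A \<inter> space M"
  have [measurable]: "?E n \<in> sets M" for n by measurable
  have m: "prob (?E n) = prob A" for n
    using measure_preserving_emeasure_funpow[OF mp A, of n] by (simp add: measure_def)
  have eq: "prob (sym_diff (?E n) A) = 2 * prob A - 2 * prob (?E n \<inter> A)" for n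
  proof -
    have "prob (sym_diff (?E n) A) = prob (?E n - A) + prob (A - ?E n)"
      by (intro finite_measure_Union) auto
    also have "\<dots> = 2 * prob A - 2 * prob (?E n \<inter> A)"
      using finite_measure_Diff'[of "?E n" A] finite_measure_Diff'[of A "?E n"] m[of n]
      by (simp add: Int_commute)
    finally show ?thesis .
  qed
  have "(\<lambda>n. prob (sym_diff (?E n) A)) \<longlonglongrightarrow> 2 * prob A - 2 * (prob A * prob A)"
    unfolding eq using mix A by (intro tendsto_intros) (auto simp: mixing_def)
  then have "(\<lambda>n. emeasure M (sym_diff (?E n) A)) \<longlonglongrightarrow> ennreal (2 * prob A - 2 * (prob A * prob A))"
    unfolding emeasure_eq_measure by (rule tendsto_ennrealI)
  then have "liminf (\<lambda>n. emeasure M (sym_diff (?E n) A)) = ennreal (2 * prob A - 2 * (prob A * prob A))"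
    by (rule lim_imp_Liminf[rotated]) simp
  moreover have "prob A * prob A < prob A" using pos by simp
  ultimately show "0 < liminf (\<lambda>n. emeasure M (sym_diff (?E n) A))" by simp
qed

lemma (in prob_space) mildly_mixing_recurrent_set_trivial:
  assumes mild: "mildly_mixing M T" and A: "A \<in> sets M"
    and rec: "\<And>c. 0 < c \<Longrightarrow> \<exists>\<^sub>\<infinity>n. emeasure M (sym_diff ((T ^^ n) -` A \<inter> space M) A) < c"
  shows "emeasure M A = 0 \<or> emeasure M A = 1"
proof (rule ccontr)
  assume "\<not> ?thesis"
  then have "0 < emeasure M A \<and> emeasure M A < 1"
    using emeasure_le_1[of A] by (auto simp: less_le zero_less_iff_neq_zero)
  then have "0 < liminf (\<lambda>n. emeasure M (sym_diff ((T ^^ n) -` A \<inter> space M) A))"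
    using mild A unfolding mildly_mixing_def by blast
  then obtain c where "0 < c"
    and c: "c < liminf (\<lambda>n. emeasure M (sym_diff ((T ^^ n) -` A \<inter> space M) A))"
    using dense by blast
  have "\<forall>\<^sub>\<infinity>n. c < emeasure M (sym_diff ((T ^^ n) -` A \<inter> space M) A)"
    using less_LiminfD[OF c] by (simp add: cofinite_eq_sequentially)
  then have "\<forall>\<^sub>\<infinity>n. \<not> emeasure M (sym_diff ((T ^^ n) -` A \<inter> space M) A) < c"
    by (rule eventually_mono) (simp add: less_imp_le not_less)
  with rec[OF \<open>0 < c\<close>] show False by (simp add: frequently_def)
qed

text \<open>
  In the pseudometric of symmetric differences, the slices of one product-measurable set form a
  separable family, even if the measure algebra itself is not separable: a rectangle has two
  slices, and the property passes to complements and to countable unions, where the measures of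
  the tails tend to zero.
\<close>

lemma (in finite_measure) sets_pair_countable_dense_slices:
  assumes A: "A \<in> sets (M \<Otimes>\<^sub>M N)"
  shows "\<exists>D\<subseteq>sets M. countable D \<and>
    (\<forall>y\<in>space N. \<forall>e>0. \<exists>d\<in>D. measure M (sym_diff (slice A y) d) < e)"
proof -
  have "A \<in> sigma_sets (space M \<times> space N) {a \<times> b |a b. a \<in> sets M \<and> b \<in> sets N}"
    using A by (simp add: sets_pair_measure)
  then show ?thesis
  proof (induction A rule: sigma_sets.induct)
    case (Basic A)
    then obtain a b where "A = a \<times> b" "a \<in> sets M" by auto
    then have "slice A y = (if y \<in> b then a else {})" for y by auto
    with \<open>a \<in> sets M\<close> show ?case
      by (intro exI[of _ "{a, {}}"]) simp
  next
    case Empty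
    show ?case by (rule exI[of _ "{{}}"]) auto
  next
    case (Compl A)
    then obtain D where D: "D \<subseteq> sets M" "countable D"
      "\<And>y e. y \<in> space N \<Longrightarrow> e > 0 \<Longrightarrow> \<exists>d\<in>D. measure M (sym_diff (slice A y) d) < e"
      by metis
    show ?case
    proof (rule exI[of _ "(\<lambda>d. space M - d) ` D"], intro conjI ballI allI impI)
      fix y and e :: real assume y: "y \<in> space N" and "e > 0"
      then obtain d where d: "d \<in> D" "measure M (sym_diff (slice A y) d) < e" using D(3) by blast
      have "A \<subseteq> space M \<times> space N"
        using sigma_sets_into_sp[OF _ Compl(1)] by (force dest: sets.sets_into_space)
      then have "sym_diff (slice (space M \<times> space N - A) y) (space M - d) = sym_diff (slice A y) d"
        using y sets.sets_into_space[of d M] d subsetD[OF D(1)] by auto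
      with d show "\<exists>d\<in>(\<lambda>d. space M - d) ` D. measure M (sym_diff (slice (space M \<times> space N - A) y) d) < e"
        by (intro bexI[of _ "space M - d"]) simp_all
    qed (use D in auto)
  next
    case (Union A)
    then have "\<forall>i. \<exists>D. D \<subseteq> sets M \<and> countable D \<and>
      (\<forall>y\<in>space N. \<forall>e>0. \<exists>d\<in>D. measure M (sym_diff (slice (A i) y) d) < e)" by auto
    then obtain D where D: "\<And>i. D i \<subseteq> sets M" "\<And>i. countable (D i)"
      "\<And>i y e. y \<in> space N \<Longrightarrow> e > 0 \<Longrightarrow> \<exists>d\<in>D i. measure M (sym_diff (slice (A i) y) d) < e"
      by metis
    have As: "slice (A i) y \<in> sets M" for i y
      using Union(1)[of i] by (intro sets_Pair2[of _ M N]) (simp add: sets_pair_measure)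
    show ?case
    proof (rule exI[of _ "(\<lambda>l. \<Union>(set l)) ` lists (\<Union>i. D i)"], intro conjI ballI allI impI)
      show "(\<lambda>l. \<Union>(set l)) ` lists (\<Union>i. D i) \<subseteq> sets M"
        using D(1) by (auto intro!: sets.finite_Union) (meson D(1) in_mono)
      show "countable ((\<lambda>l. \<Union>(set l)) ` lists (\<Union>i. D i))"
        using D(2) by (intro countable_image countable_lists countable_UN) auto
      fix y and e :: real assume y: "y \<in> space N" and e: "e > 0"
      let ?A = "\<lambda>i. slice (A i) y"
      let ?R = "\<lambda>k. (\<Union>i. ?A i) - (\<Union>i<k. ?A i)"
      have "(\<lambda>k. measure M (?R k)) \<longlonglongrightarrow> measure M (\<Inter>k. ?R k)"
        using As by (intro finite_Lim_measure_decseq) (auto simp: decseq_def)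
      also have "(\<Inter>k. ?R k) = {}" by auto
      finally have "(\<lambda>k. measure M (?R k)) \<longlonglongrightarrow> 0" by (simp only: measure_empty)
      then have "\<forall>\<^sub>F k in sequentially. measure M (?R k) < e / 2"
        using e by (intro order_tendstoD) auto
      then obtain k where k: "measure M (?R k) < e / 2" by (auto simp: eventually_sequentially)
      have "\<forall>i. \<exists>d\<in>D i. measure M (sym_diff (?A i) d) < e / (2 * Suc k)"
        using D(3)[OF y] e by simp
      then obtain d where d: "\<And>i. d i \<in> D i" "\<And>i. measure M (sym_diff (?A i) (d i)) < e / (2 * Suc k)"
        by metis
      have ds: "d i \<in> sets M" for i using d(1) D(1) by blast
      have "measure M (sym_diff (slice (\<Union>i. A i) y) (\<Union>i<k. d i)) \<le>
        measure M (?R k \<union> (\<Union>i<k. sym_diff (?A i) (d i)))"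
        using As ds by (intro finite_measure_mono) auto
      also have "\<dots> \<le> measure M (?R k) + measure M (\<Union>i<k. sym_diff (?A i) (d i))"
        using As ds by (intro measure_Un_le) auto
      also have "\<dots> \<le> measure M (?R k) + (\<Sum>i<k. measure M (sym_diff (?A i) (d i)))"
        using As ds by (intro add_left_mono measure_UNION_le) auto
      also have "\<dots> \<le> measure M (?R k) + (\<Sum>i<k. e / (2 * Suc k))"
        using d(2) by (intro add_left_mono sum_mono less_imp_le)
      also have "(\<Sum>i<k. e / (2 * Suc k)) \<le> e / 2"
        using e by (simp add: field_simps)
      finally have "measure M (sym_diff (slice (\<Union>i. A i) y) (\<Union>i<k. d i)) < e"
        using k by simp
      moreover have "(\<Union>i<k. d i) \<in> (\<lambda>l. \<Union>(set l)) ` lists (\<Union>i. D i)"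
        using d(1) by (intro image_eqI[of _ _ "map d [0..<k]"]) (auto simp: atLeast0LessThan, blast intro: d(1))
      ultimately show "\<exists>d\<in>(\<lambda>l. \<Union>(set l)) ` lists (\<Union>i. D i).
        measure M (sym_diff (slice (\<Union>i. A i) y) d) < e" by blast
    qed
  qed
qed

text \<open>
  The slice of an invariant set at a recurrent point \<open>y\<close> is moved little by infinitely many
  iterates of \<open>T\<close>: it is the preimage of the slice at \<open>S\<^sup>n y\<close>, which is close to the slice at
  \<open>y\<close> whenever \<open>S\<^sup>n y\<close> is back among the points whose slices are near a given set.
\<close>

theorem ergodic_map_prod:
  assumes "prob_space M" and "sigma_finite_measure N"
    and T: "measure_preserving M T" and mild: "mildly_mixing M T"
    and S: "nonsingular N S" and c: "conservative N S" and e: "ergodic N S"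
  shows "ergodic (M \<Otimes>\<^sub>M N) (map_prod T S)"
  unfolding ergodic_def
proof (intro ballI impI)
  interpret M: prob_space M by fact
  interpret N: sigma_finite_measure N by fact
  interpret pair_sigma_finite M N ..
  have Tm[measurable]: "T \<in> measurable M M" using T by (simp add: measure_preserving_def)
  note Sm[measurable] = nonsingular_measurable[OF S]
  fix A assume A[measurable]: "A \<in> sets (M \<Otimes>\<^sub>M N)"
    and inv: "map_prod T S -` A \<inter> space (M \<Otimes>\<^sub>M N) = A"
  have R: "map_prod T S \<in> measurable (M \<Otimes>\<^sub>M N) (M \<Otimes>\<^sub>M N)"
    by (rule map_prod_measurable[OF Tm Sm])
  have Aslice[measurable]: "slice A y \<in> sets M" for y by (rule sets_Pair2[OF A])
  have inv_n: "(map_prod T S ^^ n) -` A \<inter> space (M \<Otimes>\<^sub>M N) = A" for n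
  proof (induction n)
    case 0
    show ?case using sets.sets_into_space[OF A] by auto
  next
    case (Suc n)
    have "(map_prod T S ^^ Suc n) -` A \<inter> space (M \<Otimes>\<^sub>M N) =
      map_prod T S -` ((map_prod T S ^^ n) -` A \<inter> space (M \<Otimes>\<^sub>M N)) \<inter> space (M \<Otimes>\<^sub>M N)"
      using measurable_space[OF R] by (auto simp: funpow_swap1)
    then show ?case using Suc inv by (simp only:)
  qed
  have slice_n: "(T ^^ n) -` slice A ((S ^^ n) y) \<inter> space M = slice A y" if "y \<in> space N" for n y
    using slice_vimage_map_prod[OF that, where T=T and S=S and n=n and C=A and M=M]
    by (simp add: inv_n)
  obtain D where D: "D \<subseteq> sets M" "countable D"
    "\<And>y e. y \<in> space N \<Longrightarrow> e > 0 \<Longrightarrow> \<exists>d\<in>D. measure M (sym_diff (slice A y) d) < e"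
    using M.sets_pair_countable_dense_slices[OF A] by metis
  \<comment> \<open>Recurrence to these countably many sets makes the slice at \<open>S\<^sup>n y\<close> return near the slice at \<open>y\<close>.\<close>
  define B where "B d k = {y \<in> space N. emeasure M (sym_diff (slice A y) d) < inverse (of_nat (Suc k))}"
    for d k
  have "B d k \<in> sets N" if [measurable]: "d \<in> sets M" for d k
  proof -
    have "(\<lambda>y. emeasure M (slice (sym_diff A (d \<times> space N)) y)) \<in> borel_measurable N"
      by (intro measurable_emeasure_Pair2) measurable
    also have "?this \<longleftrightarrow> (\<lambda>y. emeasure M (sym_diff (slice A y) d)) \<in> borel_measurable N"
      by (intro measurable_cong arg_cong[where f="emeasure M"]) auto
    finally show ?thesis unfolding B_def by measurable
  qed
  then have "AE y in N. \<forall>d\<in>D. \<forall>k. y \<in> B d k \<longrightarrow> (\<exists>\<^sub>\<infinity>n. (S ^^ n) y \<in> B d k)"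
    using D(1,2) by (auto simp: AE_ball_countable AE_all_countable intro!: conservative_recurrence[OF S c])
  then have triv: "AE y in N. emeasure M (slice A y) = 0 \<or> emeasure M (slice A y) = 1"
    using AE_space
  proof eventually_elim
    case (elim y)
    show ?case
    proof (rule M.mildly_mixing_recurrent_set_trivial[OF mild Aslice])
      fix c :: ennreal assume "0 < c"
      then have "0 < c / 2" by (simp add: ennreal_zero_less_divide)
      then obtain k where k: "inverse (of_nat (Suc k)) \<le> c / 2" using ennreal_ex_inverse_le by blast
      obtain d where d: "d \<in> D" "measure M (sym_diff (slice A y) d) < inverse (real (Suc k))"
        using D(3)[OF elim(2), of "inverse (real (Suc k))"] by auto
      then have [measurable]: "d \<in> sets M" using D(1) by auto
      have "emeasure M (sym_diff (slice A y) d) < ennreal (inverse (real (Suc k)))"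
        unfolding M.emeasure_eq_measure using d(2) by (intro ennreal_lessI) auto
      also have "ennreal (inverse (real (Suc k))) = inverse (of_nat (Suc k))"
        by (simp only: ennreal_of_nat_eq_real_of_nat inverse_ennreal of_nat_0_less_iff zero_less_Suc)
      finally have near: "emeasure M (sym_diff (slice A y) d) < inverse (of_nat (Suc k))" .
      then have dy: "emeasure M (sym_diff (slice A y) d) < c / 2" using k by (rule less_le_trans)
      with d have "y \<in> B d k"
        using elim(2) near by (simp only: B_def mem_Collect_eq simp_thms)
      with elim(1) d have "\<exists>\<^sub>\<infinity>n. (S ^^ n) y \<in> B d k" by blast
      then show "\<exists>\<^sub>\<infinity>n. emeasure M (sym_diff ((T ^^ n) -` slice A y \<inter> space M) (slice A y)) < c"
      proof (rule INFM_mono)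
        fix n assume n: "(S ^^ n) y \<in> B d k"
        have "sym_diff ((T ^^ n) -` slice A y \<inter> space M) (slice A y) =
          (T ^^ n) -` sym_diff (slice A y) (slice A ((S ^^ n) y)) \<inter> space M"
          using slice_n[OF elim(2), of n] by auto
        then have "emeasure M (sym_diff ((T ^^ n) -` slice A y \<inter> space M) (slice A y)) =
          emeasure M (sym_diff (slice A y) (slice A ((S ^^ n) y)))"
          by (simp only:) (rule measure_preserving_emeasure_funpow[OF T], measurable)
        also have "\<dots> \<le> emeasure M (sym_diff (slice A y) d \<union> sym_diff (slice A ((S ^^ n) y)) d)"
          by (intro emeasure_mono) auto
        also have "\<dots> \<le> emeasure M (sym_diff (slice A y) d) + emeasure M (sym_diff (slice A ((S ^^ n) y)) d)"
          by (intro emeasure_subadditive) auto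
        also have "\<dots> < c / 2 + c / 2"
          using n k dy by (intro add_strict_mono) (auto simp: B_def)
        also have "c / 2 + c / 2 = c"
          by (cases c) (simp_all add: ennreal_divide_numeral ennreal_plus[symmetric] ennreal_top_divide del: ennreal_plus)
        finally show "emeasure M (sym_diff ((T ^^ n) -` slice A y \<inter> space M) (slice A y)) < c" .
      qed
    qed
  qed
  define Y where "Y = {y \<in> space N. emeasure M (slice A y) = 1}"
  have [measurable]: "(\<lambda>y. emeasure M (slice A y)) \<in> borel_measurable N"
    by (rule measurable_emeasure_Pair2[OF A])
  have "Y \<in> sets N" unfolding Y_def by measurable
  moreover have "S -` Y \<inter> space N = Y"
  proof -
    have "emeasure M (slice A (S y)) = emeasure M (slice A y)" if "y \<in> space N" for y
      using measure_preserving_emeasure_funpow[OF T Aslice[of "S y"], of 1] slice_n[OF that, of 1] by simp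
    then show ?thesis using measurable_space[OF Sm] by (auto simp: Y_def)
  qed
  ultimately have "emeasure N Y = 0 \<or> emeasure N (space N - Y) = 0"
    using e unfolding ergodic_def by blast
  then show "emeasure (M \<Otimes>\<^sub>M N) A = 0 \<or> emeasure (M \<Otimes>\<^sub>M N) (space (M \<Otimes>\<^sub>M N) - A) = 0"
  proof
    assume "emeasure N Y = 0"
    then have "AE y in N. y \<notin> Y" using \<open>Y \<in> sets N\<close> by (intro AE_not_in) auto
    with triv have "AE y in N. emeasure M (slice A y) = 0"
      using AE_space by eventually_elim (auto simp: Y_def)
    then show ?thesis by (simp add: emeasure_eq_0_iff_AE_slice[OF A])
  next
    assume "emeasure N (space N - Y) = 0"
    then have "AE y in N. y \<notin> space N - Y" using \<open>Y \<in> sets N\<close> by (intro AE_not_in) auto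
    then have "AE y in N. emeasure M (slice (space (M \<Otimes>\<^sub>M N) - A) y) = 0"
      using AE_space
    proof eventually_elim
      case (elim y)
      have "slice (space (M \<Otimes>\<^sub>M N) - A) y = space M - slice A y"
        using elim by (auto simp: space_pair_measure)
      then show ?case using elim by (simp add: emeasure_compl Y_def M.emeasure_space_1)
    qed
    then show ?thesis by (subst (2) emeasure_eq_0_iff_AE_slice) auto
  qed
qed

section \<open>Restricted sensitivity of the product\<close>

lemma measurable_metric_max:
  assumes dX: "measurable_metric M dX" and dY: "measurable_metric N dY"
  shows "measurable_metric (M \<Otimes>\<^sub>M N) (\<lambda>(x1, y1) (x2, y2). max (dX x1 x2) (dY y1 y2))"
proof -
  interpret X: Metric_space "space M" dX using dX by (simp add: measurable_metric_def)
  interpret Y: Metric_space "space N" dY using dY by (simp add: measurable_metric_def)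
  have [measurable]: "(\<lambda>(x, y). dX x y) \<in> borel_measurable (M \<Otimes>\<^sub>M M)"
    "(\<lambda>(x, y). dY x y) \<in> borel_measurable (N \<Otimes>\<^sub>M N)"
    using dX dY by (simp_all add: measurable_metric_def)
  have max_zero: "max a b = 0 \<longleftrightarrow> a = 0 \<and> b = 0" if "0 \<le> a" "0 \<le> b" for a b :: real
    using that by (auto simp: max_def)
  have "Metric_space (space (M \<Otimes>\<^sub>M N)) (\<lambda>(x1, y1) (x2, y2). max (dX x1 x2) (dY y1 y2))"
  proof
    fix x y z assume "x \<in> space (M \<Otimes>\<^sub>M N)" "y \<in> space (M \<Otimes>\<^sub>M N)" "z \<in> space (M \<Otimes>\<^sub>M N)"
    then show "(case x of (x1, y1) \<Rightarrow> \<lambda>(x2, y2). max (dX x1 x2) (dY y1 y2)) z \<le>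
      (case x of (x1, y1) \<Rightarrow> \<lambda>(x2, y2). max (dX x1 x2) (dY y1 y2)) y +
      (case y of (x1, y1) \<Rightarrow> \<lambda>(x2, y2). max (dX x1 x2) (dY y1 y2)) z"
      using X.triangle[of "fst x" "fst y" "fst z"] Y.triangle[of "snd x" "snd y" "snd z"]
      by (auto simp: space_pair_measure split: prod.splits)
  next
    fix x y assume "x \<in> space (M \<Otimes>\<^sub>M N)" "y \<in> space (M \<Otimes>\<^sub>M N)"
    then have "max (dX (fst x) (fst y)) (dY (snd x) (snd y)) = 0 \<longleftrightarrow> fst x = fst y \<and> snd x = snd y"
      using max_zero[OF X.nonneg Y.nonneg, of "fst x" "fst y" "snd x" "snd y"]
        X.zero[of "fst x" "fst y"] Y.zero[of "snd x" "snd y"]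
      by (auto simp: space_pair_measure)
    then show "((case x of (x1, y1) \<Rightarrow> \<lambda>(x2, y2). max (dX x1 x2) (dY y1 y2)) y = 0) = (x = y)"
      by (simp add: split_beta' prod_eq_iff)
  qed (auto simp: X.commute Y.commute max_def split: prod.splits)
  moreover have "(\<lambda>(z, w). (\<lambda>(x1, y1) (x2, y2). max (dX x1 x2) (dY y1 y2)) z w)
    \<in> borel_measurable ((M \<Otimes>\<^sub>M N) \<Otimes>\<^sub>M (M \<Otimes>\<^sub>M N))"
    unfolding split_beta' by measurable
  ultimately show ?thesis by (simp add: measurable_metric_def)
qed

lemma measurable_metric_dist:
  assumes "measurable_metric M d" and [measurable]: "f \<in> measurable L M" "g \<in> measurable L M"
  shows "(\<lambda>w. d (f w) (g w)) \<in> borel_measurable L"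
proof -
  have [measurable]: "(\<lambda>(x, y). d x y) \<in> borel_measurable (M \<Otimes>\<^sub>M M)"
    using assms(1) by (simp add: measurable_metric_def)
  have "(\<lambda>w. (\<lambda>(x, y). d x y) (f w, g w)) \<in> borel_measurable L" by measurable
  then show ?thesis by simp
qed

lemma measurable_metric_mball:
  assumes d: "measurable_metric M d"
  shows "Metric_space.mball (space M) d z r \<in> sets M"
proof (cases "z \<in> space M")
  case True
  interpret Metric_space "space M" d using d by (simp add: measurable_metric_def)
  have [measurable]: "(\<lambda>w. d z w) \<in> borel_measurable M"
    using True by (intro measurable_metric_dist[OF d]) auto
  have "mball z r = {w \<in> space M. d z w < r}" using True by (auto simp: mball_def)
  then show ?thesis by simp
next
  case False
  interpret Metric_space "space M" d using d by (simp add: measurable_metric_def)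
  show ?thesis using False by (simp add: mball_def)
qed

lemma mball_max:
  assumes "Metric_space X dX" and "Metric_space Y dY"
    and "Metric_space (X \<times> Y) (\<lambda>(x1, y1) (x2, y2). max (dX x1 x2) (dY y1 y2))"
  shows "Metric_space.mball (X \<times> Y) (\<lambda>(x1, y1) (x2, y2). max (dX x1 x2) (dY y1 y2)) (x, y) r =
    Metric_space.mball X dX x r \<times> Metric_space.mball Y dY y r"
  unfolding Metric_space.mball_def[OF assms(1)] Metric_space.mball_def[OF assms(2)]
    Metric_space.mball_def[OF assms(3)] by auto

lemma (in pair_sigma_finite) AE_snd:
  assumes "AE y in M2. P y"
  shows "AE z in M1 \<Otimes>\<^sub>M M2. P (snd z)"
proof -
  obtain E where E: "{y \<in> space M2. \<not> P y} \<subseteq> E" "emeasure M2 E = 0" "E \<in> sets M2"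
    using AE_E[OF assms] by metis
  then have "AE z in M1 \<Otimes>\<^sub>M M2. z \<notin> space M1 \<times> E"
    by (intro AE_not_in null_setsI) (simp_all add: M2.emeasure_pair_measure_Times)
  then show ?thesis
    using AE_space by eventually_elim (use E(1) in \<open>auto simp: space_pair_measure\<close>)
qed

text \<open>
  Positivity of the balls in the second factor is used twice: it makes the logarithm of the
  measure of a product ball the sum of two finite logarithms, of which the second is at most zero,
  and it makes the sensitive part of the product ball non-null.
\<close>

theorem restricted_sensitive_map_prod:
  assumes rs: "restricted_sensitive M dX T" and "prob_space N"
    and dY: "measurable_metric N dY" and pos: "ae_positive_balls N dY"
    and R: "nonsingular (M \<Otimes>\<^sub>M N) (map_prod T S)" and S: "nonsingular N S"
  shows "restricted_sensitive (M \<Otimes>\<^sub>M N)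
    (\<lambda>(x1, y1) (x2, y2). max (dX x1 x2) (dY y1 y2)) (map_prod T S)"
proof -
  interpret M: prob_space M using rs by (simp add: restricted_sensitive_def)
  interpret N: prob_space N by fact
  interpret pair_prob_space M N ..
  have dX: "measurable_metric M dX" and T: "nonsingular M T"
    using rs by (simp_all add: restricted_sensitive_def)
  note [measurable] = nonsingular_measurable[OF T] nonsingular_measurable[OF S]
  let ?d = "\<lambda>(x1, y1) (x2, y2). max (dX x1 x2) (dY y1 y2)"
  let ?BX = "Metric_space.mball (space M) dX" and ?BY = "Metric_space.mball (space N) dY"
  let ?B = "Metric_space.mball (space (M \<Otimes>\<^sub>M N)) ?d"
  note d = measurable_metric_max[OF dX dY]
  have ball: "?B (x, y) r = ?BX x r \<times> ?BY y r" for x y r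
    using dX dY d unfolding measurable_metric_def space_pair_measure by (intro mball_max) auto
  have BX[measurable]: "?BX x r \<in> sets M" for x r by (rule measurable_metric_mball[OF dX])
  have BY[measurable]: "?BY y r \<in> sets N" for y r by (rule measurable_metric_mball[OF dY])
  have mball: "measure (M \<Otimes>\<^sub>M N) (A \<times> B) = measure M A * measure N B"
    if "A \<in> sets M" "B \<in> sets N" for A B
    using that by (simp add: measure_def N.emeasure_pair_measure_Times enn2real_mult)
  have "AE x in M. \<exists>\<delta>>0. \<exists>a>0. \<forall>\<epsilon>>0. \<exists>n::nat.
      real n \<le> - a * ln (measure M (?BX x \<epsilon>)) \<and>
      measure M {w \<in> ?BX x \<epsilon>. dX ((T ^^ n) x) ((T ^^ n) w) > \<delta>} > 0" (is "AE x in M. ?PX x")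
    using rs by (simp add: restricted_sensitive_def)
  then have X: "AE z in M \<Otimes>\<^sub>M N. ?PX (fst z)"
    using AE_distrD[of fst "M \<Otimes>\<^sub>M N" M ?PX] by (simp only: N.distr_pair_fst measurable_fst)
  have "AE z in M \<Otimes>\<^sub>M N. \<forall>\<epsilon>>0. measure N (?BY (snd z) \<epsilon>) > 0"
    using pos unfolding ae_positive_balls_def by (rule AE_snd)
  with X have "AE z in M \<Otimes>\<^sub>M N. \<exists>\<delta>>0. \<exists>a>0. \<forall>\<epsilon>>0. \<exists>n::nat.
      real n \<le> - a * ln (measure (M \<Otimes>\<^sub>M N) (?B z \<epsilon>)) \<and>
      measure (M \<Otimes>\<^sub>M N) {w \<in> ?B z \<epsilon>. ?d ((map_prod T S ^^ n) z) ((map_prod T S ^^ n) w) > \<delta>} > 0"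
    using AE_space
  proof eventually_elim
    case (elim z)
    obtain x y where z: "z = (x, y)" by fastforce
    have xy: "x \<in> space M" "y \<in> space N" using elim z by (auto simp: space_pair_measure)
    obtain \<delta> a where "\<delta> > 0" "a > 0" and ex: "\<And>\<epsilon>. \<epsilon> > 0 \<Longrightarrow> \<exists>n::nat. real n \<le> - a * ln (measure M (?BX x \<epsilon>)) \<and>
      measure M {w \<in> ?BX x \<epsilon>. dX ((T ^^ n) x) ((T ^^ n) w) > \<delta>} > 0"
      using elim(1) z by auto
    have "\<forall>\<epsilon>>0. \<exists>n::nat. real n \<le> - a * ln (measure (M \<Otimes>\<^sub>M N) (?B z \<epsilon>)) \<and>
      measure (M \<Otimes>\<^sub>M N) {w \<in> ?B z \<epsilon>. ?d ((map_prod T S ^^ n) z) ((map_prod T S ^^ n) w) > \<delta>} > 0"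
    proof (intro allI impI)
      fix \<epsilon> :: real assume "\<epsilon> > 0"
      then obtain n :: nat where n: "real n \<le> - a * ln (measure M (?BX x \<epsilon>))"
        and n': "measure M {w \<in> ?BX x \<epsilon>. dX ((T ^^ n) x) ((T ^^ n) w) > \<delta>} > 0"
        using ex by blast
      have y: "measure N (?BY y \<epsilon>) > 0" using elim(2) \<open>\<epsilon> > 0\<close> z by auto
      have "{w \<in> ?BX x \<epsilon>. dX ((T ^^ n) x) ((T ^^ n) w) > \<delta>} \<subseteq> ?BX x \<epsilon>" by auto
      then have x: "measure M (?BX x \<epsilon>) > 0"
        using n' M.finite_measure_mono[OF _ BX] by (meson less_le_trans)
      have "ln (measure N (?BY y \<epsilon>)) \<le> 0" using y by simp
      then have "- a * ln (measure M (?BX x \<epsilon>)) \<le>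
        - a * (ln (measure M (?BX x \<epsilon>)) + ln (measure N (?BY y \<epsilon>)))"
        using \<open>a > 0\<close> by (intro mult_left_mono_neg) auto
      also have "ln (measure M (?BX x \<epsilon>)) + ln (measure N (?BY y \<epsilon>)) = ln (measure (M \<Otimes>\<^sub>M N) (?B z \<epsilon>))"
        unfolding z ball using x y by (simp add: mball ln_mult)
      finally have bound: "real n \<le> - a * ln (measure (M \<Otimes>\<^sub>M N) (?B z \<epsilon>))" using n by simp
      have m1[measurable]: "(\<lambda>w. dX ((T ^^ n) x) ((T ^^ n) w)) \<in> borel_measurable M"
        using xy by (intro measurable_metric_dist[OF dX] measurable_const measurable_space[of "T ^^ n" M M]) measurable
      have s1: "{w \<in> ?BX x \<epsilon>. dX ((T ^^ n) x) ((T ^^ n) w) > \<delta>} \<in> sets M"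
      proof -
        have "{w \<in> ?BX x \<epsilon>. dX ((T ^^ n) x) ((T ^^ n) w) > \<delta>} =
          ?BX x \<epsilon> \<inter> {w \<in> space M. dX ((T ^^ n) x) ((T ^^ n) w) > \<delta>}"
          using sets.sets_into_space[OF BX] by auto
        also have "\<dots> \<in> sets M" by measurable
        finally show ?thesis .
      qed
      have m2[measurable]: "(\<lambda>w. ?d ((map_prod T S ^^ n) z) ((map_prod T S ^^ n) w)) \<in> borel_measurable (M \<Otimes>\<^sub>M N)"
        using elim(3) nonsingular_measurable[OF R]
        by (intro measurable_metric_dist[OF d] measurable_const measurable_space[of "map_prod T S ^^ n" "M \<Otimes>\<^sub>M N" "M \<Otimes>\<^sub>M N"] measurable_compose_n)
      have B2: "?B z \<epsilon> \<in> sets (M \<Otimes>\<^sub>M N)" by (rule measurable_metric_mball[OF d])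
      have s2: "{w \<in> ?B z \<epsilon>. ?d ((map_prod T S ^^ n) z) ((map_prod T S ^^ n) w) > \<delta>} \<in> sets (M \<Otimes>\<^sub>M N)"
      proof -
        have "{w \<in> ?B z \<epsilon>. ?d ((map_prod T S ^^ n) z) ((map_prod T S ^^ n) w) > \<delta>} =
          ?B z \<epsilon> \<inter> {w \<in> space (M \<Otimes>\<^sub>M N). ?d ((map_prod T S ^^ n) z) ((map_prod T S ^^ n) w) > \<delta>}"
          using sets.sets_into_space[OF B2] by auto
        also have "\<dots> \<in> sets (M \<Otimes>\<^sub>M N)" using B2 by measurable
        finally show ?thesis .
      qed
      have "0 < measure (M \<Otimes>\<^sub>M N) ({w \<in> ?BX x \<epsilon>. dX ((T ^^ n) x) ((T ^^ n) w) > \<delta>} \<times> ?BY y \<epsilon>)"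
        using n' y s1 by (simp add: mball)
      also have "\<dots> \<le> measure (M \<Otimes>\<^sub>M N) {w \<in> ?B z \<epsilon>. ?d ((map_prod T S ^^ n) z) ((map_prod T S ^^ n) w) > \<delta>}"
        by (rule finite_measure_mono[OF _ s2]) (auto simp: z ball map_prod_funpow less_max_iff_disj)
      finally have "0 < measure (M \<Otimes>\<^sub>M N) {w \<in> ?B z \<epsilon>. ?d ((map_prod T S ^^ n) z) ((map_prod T S ^^ n) w) > \<delta>}" .
      with bound show "\<exists>n::nat. real n \<le> - a * ln (measure (M \<Otimes>\<^sub>M N) (?B z \<epsilon>)) \<and>
        measure (M \<Otimes>\<^sub>M N) {w \<in> ?B z \<epsilon>. ?d ((map_prod T S ^^ n) z) ((map_prod T S ^^ n) w) > \<delta>} > 0"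
        by blast
    qed
    with \<open>\<delta> > 0\<close> \<open>a > 0\<close> show ?case by blast
  qed
  then show ?thesis
    using R d prob_space_axioms by (simp add: restricted_sensitive_def)
qed

section \<open>Invariant measures\<close>

lemma (in sigma_finite_measure) AE_le_if_nn_integral_le:
  fixes f g :: "'a \<Rightarrow> ennreal"
  assumes [measurable]: "f \<in> borel_measurable M" "g \<in> borel_measurable M"
    and fin: "AE x in M. g x < \<top>"
    and le: "\<And>A. A \<in> sets M \<Longrightarrow> (\<integral>\<^sup>+x. f x * indicator A x \<partial>M) \<le> (\<integral>\<^sup>+x. g x * indicator A x \<partial>M)"
  shows "AE x in M. f x \<le> g x"
proof -
  obtain F :: "nat \<Rightarrow> 'a set" where F: "range F \<subseteq> sets M" "(\<Union>i. F i) = space M"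
    "\<And>i. emeasure M (F i) \<noteq> \<infinity>"
    using sigma_finite by blast
  have [measurable]: "F i \<in> sets M" for i using F(1) by auto
  have "AE x in M. \<forall>i n. x \<in> F i \<longrightarrow> g x \<le> of_nat n \<longrightarrow> f x \<le> g x"
    unfolding AE_all_countable
  proof (intro allI)
    fix i n :: nat
    define A where "A = {x \<in> space M. x \<in> F i \<and> g x \<le> of_nat n \<and> g x < f x}"
    have A[measurable]: "A \<in> sets M" unfolding A_def by measurable
    have "(\<integral>\<^sup>+x. g x * indicator A x \<partial>M) \<le> (\<integral>\<^sup>+x. of_nat n * indicator (F i) x \<partial>M)"
      by (intro nn_integral_mono) (auto simp: A_def indicator_def)
    also have "\<dots> = of_nat n * emeasure M (F i)"
      by (intro nn_integral_cmult_indicator) measurable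
    also have "\<dots> < \<top>" using F(3)[of i] by (simp add: less_top[symmetric] ennreal_mult_eq_top_iff)
    finally have fi: "(\<integral>\<^sup>+x. g x * indicator A x \<partial>M) < \<top>" .
    have "AE x in M. f x * indicator A x \<le> g x * indicator A x"
    proof (rule ccontr)
      assume "\<not> ?thesis"
      then have "(\<integral>\<^sup>+x. g x * indicator A x \<partial>M) < (\<integral>\<^sup>+x. f x * indicator A x \<partial>M)"
        using fi by (intro nn_integral_less) (auto simp: A_def indicator_def)
      then show False using le[OF A] by simp
    qed
    then show "AE x in M. x \<in> F i \<longrightarrow> g x \<le> of_nat n \<longrightarrow> f x \<le> g x"
      using AE_space by eventually_elim (rule impI, rule impI, rule ccontr, simp add: A_def not_le)
  qed
  with fin show ?thesis
    using AE_space
  proof eventually_elim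
    case (elim x)
    then obtain i n where "x \<in> F i" "g x < of_nat n" using F(2) ennreal_Ex_less_of_nat by blast
    with elim show ?case by (meson less_imp_le)
  qed
qed

text \<open>
  Let \<open>u\<close> be the deficit, the measure with \<open>\<kappa>(A) = u(A) + \<kappa>(S\<^sup>-\<^sup>1 A)\<close>. Iterating this equation
  bounds the sum of the \<open>u(S\<^sup>-\<^sup>k A)\<close> by \<open>\<kappa>(A)\<close>. But that sum is the \<open>u\<close>-integral of the number
  of visits to \<open>A\<close>, which is infinite at almost every point of \<open>A\<close>; so \<open>u(A) = 0\<close> as soon as
  \<open>\<kappa>(A)\<close> is finite.
\<close>

lemma conservative_subinvariant_imp_measure_preserving:
  assumes S: "nonsingular N S" and c: "conservative N S"
    and sets[measurable_cong]: "sets K = sets N" and "sigma_finite_measure K" and ac: "absolutely_continuous N K"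
    and sub: "\<And>B. B \<in> sets N \<Longrightarrow> emeasure K (S -` B \<inter> space N) \<le> emeasure K B"
  shows "measure_preserving K S"
proof -
  interpret K: sigma_finite_measure K by fact
  note Sm[measurable] = nonsingular_measurable[OF S]
  have SK[measurable]: "S \<in> measurable K K" by measurable
  have sp: "space K = space N" using sets by (rule sets_eq_imp_space_eq)
  let ?P = "distr K K S"
  have P: "emeasure ?P B = emeasure K (S -` B \<inter> space N)" if "B \<in> sets N" for B
    using that by (subst emeasure_distr[OF SK]) (auto simp: sp sets)
  have "absolutely_continuous K ?P"
    using sub P by (auto simp: absolutely_continuous_def null_sets_def sets) (metis le_zero_eq)
  define w where "w = RN_deriv K ?P"
  have w[measurable]: "w \<in> borel_measurable K" unfolding w_def by measurable
  have Pw: "density K w = ?P"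
    unfolding w_def by (rule K.density_RN_deriv) (use \<open>absolutely_continuous K ?P\<close> in auto)
  have Pw': "emeasure K (S -` B \<inter> space N) = (\<integral>\<^sup>+x. w x * indicator B x \<partial>K)" if "B \<in> sets N" for B
    using that by (simp add: P[symmetric] Pw[symmetric] emeasure_density sets)
  have w1: "AE y in K. w y \<le> 1"
  proof (rule K.AE_le_if_nn_integral_le)
    fix A assume "A \<in> sets K"
    then show "(\<integral>\<^sup>+x. w x * indicator A x \<partial>K) \<le> (\<integral>\<^sup>+x. 1 * indicator A x \<partial>K)"
      using sub[of A] Pw'[of A] by (simp add: sets)
  qed auto
  let ?u = "\<lambda>A. \<integral>\<^sup>+y. (1 - w y) * indicator A y \<partial>K"
  have split: "emeasure K A = ?u A + emeasure K (S -` A \<inter> space N)" if A: "A \<in> sets N" for A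
  proof -
    have [measurable]: "A \<in> sets K" using A by (simp add: sets)
    have "?u A + emeasure K (S -` A \<inter> space N) = (\<integral>\<^sup>+y. (1 - w y) * indicator A y + w y * indicator A y \<partial>K)"
      unfolding Pw'[OF A] by (rule nn_integral_add[symmetric]) measurable
    also have "\<dots> = (\<integral>\<^sup>+y. indicator A y \<partial>K)"
      using w1 by (intro nn_integral_cong_AE) (auto elim!: eventually_mono simp: indicator_def diff_add_cancel_ennreal)
    finally show ?thesis by simp
  qed
  have iter: "emeasure K A = (\<Sum>k<n. ?u ((S ^^ k) -` A \<inter> space N)) + emeasure K ((S ^^ n) -` A \<inter> space N)"
    if A[measurable]: "A \<in> sets N" for A n
  proof (induction n)
    case 0
    then show ?case using sets.Int_space_eq2[OF A] by simp
  next
    case (Suc n)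
    have "S -` ((S ^^ n) -` A \<inter> space N) \<inter> space N = (S ^^ Suc n) -` A \<inter> space N"
      using measurable_space[OF Sm] by (auto simp: funpow_swap1)
    with split[of "(S ^^ n) -` A \<inter> space N"]
    have "emeasure K ((S ^^ n) -` A \<inter> space N) = ?u ((S ^^ n) -` A \<inter> space N) + emeasure K ((S ^^ Suc n) -` A \<inter> space N)"
      by (metis measurable_sets[OF measurable_compose_n[OF Sm] A])
    with Suc show ?case by (simp only: sum.lessThan_Suc add.assoc)
  qed
  have zero: "?u A = 0" if A[measurable]: "A \<in> sets N" and fin: "emeasure K A < \<top>" for A
  proof (rule ccontr)
    assume "?u A \<noteq> 0"
    have "AE y in N. y \<in> A \<longrightarrow> (\<Sum>k. indicator A ((S ^^ k) y)) = (\<top>::ennreal)"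
      using conservative_recurrence[OF S c A]
      by eventually_elim (auto intro!: suminf_top_if_frequently_ge[of 1] elim!: INFM_mono simp: indicator_def)
    then have AE: "AE y in K. y \<in> A \<longrightarrow> (\<Sum>k. indicator A ((S ^^ k) y)) = (\<top>::ennreal)"
      using ac by (intro absolutely_continuous_AE[OF sets])
    \<comment> \<open>The \<open>u\<close>-integral over \<open>A\<close> of the number of visits to \<open>A\<close>.\<close>
    have "\<top> = \<top> * ?u A" using \<open>?u A \<noteq> 0\<close> by (simp add: ennreal_top_mult)
    also have "\<dots> = (\<integral>\<^sup>+y. \<top> * ((1 - w y) * indicator A y) \<partial>K)"
      by (rule nn_integral_cmult[symmetric]) measurable
    also have "\<dots> \<le> (\<integral>\<^sup>+y. (\<Sum>k. (1 - w y) * indicator ((S ^^ k) -` A \<inter> space N) y) \<partial>K)"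
    proof (rule nn_integral_mono_AE)
      show "AE y in K. \<top> * ((1 - w y) * indicator A y) \<le> (\<Sum>k. (1 - w y) * indicator ((S ^^ k) -` A \<inter> space N) y)"
        using AE AE_space
      proof eventually_elim
        case (elim y)
        then have "indicator ((S ^^ k) -` A \<inter> space N) y = (indicator A ((S ^^ k) y) :: ennreal)" for k
          by (auto simp: indicator_def sp)
        then show ?case using elim
          by (cases "y \<in> A") (auto simp: mult.commute)
      qed
    qed
    also have "\<dots> = (\<Sum>k. ?u ((S ^^ k) -` A \<inter> space N))"
      by (rule nn_integral_suminf) measurable
    also have "\<dots> \<le> emeasure K A"
      unfolding suminf_eq_SUP
    proof (intro SUP_least)
      show "(\<Sum>k<n. ?u ((S ^^ k) -` A \<inter> space N)) \<le> emeasure K A" for n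
        by (subst iter[OF A, of n]) simp
    qed
    finally show False using fin by simp
  qed
  obtain F :: "nat \<Rightarrow> 'a set" where F: "range F \<subseteq> sets K" "(\<Union>i. F i) = space K"
    "\<And>i. emeasure K (F i) \<noteq> \<infinity>"
    using K.sigma_finite by blast
  have F': "F i \<in> sets K" for i using F(1) by auto
  have "AE y in K. \<forall>i. (1 - w y) * indicator (F i) y = 0"
    unfolding AE_all_countable
  proof
    fix i
    have "?u (F i) = 0" using F' F(3)[of i] by (intro zero) (auto simp: sets less_top)
    then show "AE y in K. (1 - w y) * indicator (F i) y = 0"
      using F' by (subst (asm) nn_integral_0_iff_AE) auto
  qed
  then have w_eq: "AE y in K. w y = 1"
    using w1 AE_space
  proof eventually_elim
    case (elim y)
    then obtain i where "y \<in> F i" using F(2) by auto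
    with elim have "1 - w y = 0" by (metis indicator_simps(1) mult.right_neutral)
    with elim show ?case by (metis diff_add_cancel_ennreal add_0)
  qed
  have "emeasure K (S -` A \<inter> space N) = emeasure K A" if A: "A \<in> sets N" for A
  proof -
    have "(\<integral>\<^sup>+x. w x * indicator A x \<partial>K) = (\<integral>\<^sup>+x. indicator A x \<partial>K)"
      using w_eq by (intro nn_integral_cong_AE) (auto elim!: eventually_mono)
    then show ?thesis using A by (simp add: Pw' sets)
  qed
  then show ?thesis by (auto simp: measure_preserving_def sp sets SK)
qed

section \<open>The type of the product\<close>

text \<open>
  The largest \<open>a\<close> for which the mean of \<open>g\<close> truncated at \<open>a\<close> is at least \<open>a / 2\<close>: a substitute
  for the integral of \<open>g\<close> that is homogeneous of degree one and finite for every finite function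
  on a probability space. The supremum is taken over rational levels, which keeps it measurable
  in a parameter; the next two lemmas show that it is nevertheless the maximum over all finite
  levels.
\<close>

definition half_level :: "'a measure \<Rightarrow> ('a \<Rightarrow> ennreal) \<Rightarrow> ennreal" where
  "half_level M g = (SUP r\<in>\<rat>. if ennreal r \<le> 2 * (\<integral>\<^sup>+x. min (g x) (ennreal r) \<partial>M) then ennreal r else 0)"

lemma half_level_le:
  "half_level M g \<le> 2 * (\<integral>\<^sup>+x. min (g x) (half_level M g) \<partial>M)"
proof -
  have "ennreal r \<le> 2 * (\<integral>\<^sup>+x. min (g x) (half_level M g) \<partial>M)"
    if "r \<in> \<rat>" and r: "ennreal r \<le> 2 * (\<integral>\<^sup>+x. min (g x) (ennreal r) \<partial>M)" for r
  proof -
    have "ennreal r \<le> half_level M g"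
      unfolding half_level_def using that by (intro SUP_upper2[of r]) auto
    then have "(\<integral>\<^sup>+x. min (g x) (ennreal r) \<partial>M) \<le> (\<integral>\<^sup>+x. min (g x) (half_level M g) \<partial>M)"
      by (intro nn_integral_mono) (auto simp: min_le_iff_disj min_def)
    with r show ?thesis by (meson mult_left_mono order_trans zero_le)
  qed
  then show ?thesis
    by (subst half_level_def) (rule SUP_least, simp)
qed

text \<open>
  By concavity of \<open>a \<mapsto> min (g x) a\<close>, a level that is reached forces every smaller
  level to be reached; the rational ones among them exhaust it.
\<close>

lemma half_level_greatest:
  assumes [measurable]: "g \<in> borel_measurable M"
    and c: "c < \<top>" "c \<le> 2 * (\<integral>\<^sup>+x. min (g x) c \<partial>M)"
  shows "c \<le> half_level M g"
proof (rule dense_le)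
  fix b assume "b < c"
  obtain c' where c': "c = ennreal c'" "0 \<le> c'" using c(1) by (cases c) auto
  obtain b' where b': "b = ennreal b'" "0 \<le> b'" using \<open>b < c\<close> c(1) by (cases b) auto
  have "b' < c'" using \<open>b < c\<close> c' b' by (simp add: ennreal_less_iff)
  then obtain r where r: "r \<in> \<rat>" "b' < r" "r < c'" using Rats_dense_in_real by blast
  define t where "t = r / c'"
  have t: "0 \<le> t" "t \<le> 1" "t * c' = r" using r b' by (auto simp: t_def)
  have "ennreal t * min (g x) c \<le> min (g x) (ennreal r)" for x
  proof -
    have "ennreal t * min (g x) c \<le> 1 * g x"
      using t by (intro mult_mono) auto
    moreover have "ennreal t * min (g x) c \<le> ennreal t * c" by (intro mult_left_mono) auto
    moreover have "ennreal t * c = ennreal r" using t c' by (simp add: ennreal_mult[symmetric])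
    ultimately show ?thesis by simp
  qed
  then have "ennreal t * (\<integral>\<^sup>+x. min (g x) c \<partial>M) \<le> (\<integral>\<^sup>+x. min (g x) (ennreal r) \<partial>M)"
    by (subst nn_integral_cmult[symmetric]) (auto intro!: nn_integral_mono)
  moreover have "ennreal r = ennreal t * c" using t c' by (simp add: ennreal_mult[symmetric])
  moreover have "ennreal t * c \<le> ennreal t * (2 * (\<integral>\<^sup>+x. min (g x) c \<partial>M))"
    using c(2) by (intro mult_left_mono) auto
  ultimately have "ennreal r \<le> 2 * (\<integral>\<^sup>+x. min (g x) (ennreal r) \<partial>M)"
    by (metis (no_types, lifting) mult.left_commute mult_left_mono order_trans zero_le)
  then have "ennreal r \<le> half_level M g"
    unfolding half_level_def using r(1) by (intro SUP_upper2[of r]) auto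
  then show "b \<le> half_level M g" using r(2) b' by (meson ennreal_leI less_imp_le order_trans)
qed

text \<open>
  If \<open>g < n\<close> outside a set of measure at most \<open>1/4\<close>, the mean truncated at \<open>r\<close> is at most
  \<open>n + r / 4\<close>, and this is below \<open>r / 2\<close> once \<open>r > 4 n\<close>.
\<close>

lemma (in prob_space) half_level_finite:
  assumes [measurable]: "g \<in> borel_measurable M" and fin: "AE x in M. g x < \<top>"
  shows "half_level M g < \<top>"
proof -
  define F where "F n = {x \<in> space M. g x < of_nat n}" for n :: nat
  have F[measurable]: "F n \<in> sets M" for n unfolding F_def by measurable
  have "incseq F"
    by (auto simp: F_def incseq_def intro: less_le_trans)
  then have "(\<lambda>n. prob (F n)) \<longlonglongrightarrow> prob (\<Union>n. F n)"
    by (intro finite_Lim_measure_incseq) auto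
  also have "prob (\<Union>n. F n) = 1"
    using fin AE_space
    by (intro prob_eq_1[THEN iffD2]) (auto elim!: eventually_elim2 simp: F_def ennreal_Ex_less_of_nat)
  finally have "\<forall>\<^sub>F n in sequentially. 3/4 < prob (F n)"
    by (rule order_tendstoD) simp
  then obtain n where n: "3/4 < prob (F n)" by (auto simp: eventually_sequentially)
  then have n': "prob (space M - F n) \<le> 1/4" by (simp add: prob_compl)
  have "ennreal r \<le> of_nat (4 * n)"
    if r: "ennreal r \<le> 2 * (\<integral>\<^sup>+x. min (g x) (ennreal r) \<partial>M)" for r
  proof (cases "0 \<le> r")
    case True
    have "(\<integral>\<^sup>+x. min (g x) (ennreal r) \<partial>M) \<le>
      (\<integral>\<^sup>+x. ennreal (real n) + ennreal r * indicator (space M - F n) x \<partial>M)"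
      by (intro nn_integral_mono)
        (auto simp: F_def indicator_def ennreal_of_nat_eq_real_of_nat min_le_iff_disj intro: add_increasing)
    also have "\<dots> = ennreal (real n) + ennreal r * emeasure M (space M - F n)"
      by (subst nn_integral_add) (auto simp: emeasure_space_1 nn_integral_cmult_indicator)
    also have "\<dots> = ennreal (real n + r * prob (space M - F n))"
      using True by (simp add: emeasure_eq_measure ennreal_mult)
    also have "\<dots> \<le> ennreal (real n + r * (1/4))"
      using True n' by (intro ennreal_leI add_left_mono mult_left_mono) auto
    finally have "ennreal r \<le> 2 * ennreal (real n + r * (1/4))"
      using r by (meson mult_left_mono order_trans zero_le)
    also have "\<dots> = ennreal (2 * (real n + r * (1/4)))"
      using True by (subst ennreal_mult) auto
    finally have "r \<le> 2 * (real n + r * (1/4))"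
      using True by (subst (asm) ennreal_le_iff) auto
    then have "r \<le> real (4 * n)" by simp
    then show ?thesis by (simp add: ennreal_of_nat_eq_real_of_nat ennreal_leI del: of_nat_mult)
  qed (simp add: ennreal_neg)
  then have "half_level M g \<le> of_nat (4 * n)"
    unfolding half_level_def by (intro SUP_least) auto
  also have "\<dots> < \<top>" by (rule of_nat_less_top)
  finally show ?thesis .
qed

text \<open>
  If \<open>g \<ge> r\<close> on a set of measure at least \<open>1/2\<close>, then the level \<open>r\<close> is reached.
\<close>

lemma (in prob_space) half_level_pos:
  assumes [measurable]: "g \<in> borel_measurable M" and pos: "AE x in M. 0 < g x"
  shows "0 < half_level M g"
proof -
  define F where "F n = {x \<in> space M. inverse (of_nat (Suc n)) \<le> g x}" for n :: nat
  have F[measurable]: "F n \<in> sets M" for n unfolding F_def by measurable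
  have inv: "inverse (of_nat (Suc n)) = ennreal (inverse (real (Suc n)))" for n
    by (simp only: ennreal_of_nat_eq_real_of_nat inverse_ennreal of_nat_0_less_iff zero_less_Suc)
  have "incseq F"
    unfolding F_def inv incseq_def
    by (auto elim!: order_trans[rotated] intro!: ennreal_leI le_imp_inverse_le)
  then have "(\<lambda>n. prob (F n)) \<longlonglongrightarrow> prob (\<Union>n. F n)"
    by (intro finite_Lim_measure_incseq) auto
  also have "prob (\<Union>n. F n) = 1"
    using pos AE_space
    by (intro prob_eq_1[THEN iffD2]) (auto elim!: eventually_elim2 simp del: of_nat_Suc simp: F_def ennreal_ex_inverse_le)
  finally have "\<forall>\<^sub>F n in sequentially. 1/2 < prob (F n)"
    by (rule order_tendstoD) simp
  then obtain n where n: "1/2 < prob (F n)" by (auto simp: eventually_sequentially)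
  define r where "r = inverse (real (Suc n))"
  have r: "0 < r" "r \<in> \<rat>" by (simp_all add: r_def)
  have "ennreal r \<le> ennreal (2 * (r * prob (F n)))"
    using n r by (intro ennreal_leI) simp
  also have "\<dots> = 2 * (\<integral>\<^sup>+x. ennreal r * indicator (F n) x \<partial>M)"
    using r by (subst nn_integral_cmult_indicator) (auto simp: emeasure_eq_measure ennreal_mult)
  also have "\<dots> \<le> 2 * (\<integral>\<^sup>+x. min (g x) (ennreal r) \<partial>M)"
    by (intro mult_left_mono nn_integral_mono) (auto simp: F_def inv r_def indicator_def simp del: of_nat_Suc)
  finally have "ennreal r \<le> half_level M g"
    unfolding half_level_def using r(2) by (intro SUP_upper2[of r]) auto
  then show ?thesis using r(1) by (meson ennreal_less_zero_iff less_le_trans)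
qed

lemma (in sigma_finite_measure) borel_measurable_half_level:
  assumes [measurable]: "f \<in> borel_measurable (N \<Otimes>\<^sub>M M)"
  shows "(\<lambda>y. half_level M (\<lambda>x. f (y, x))) \<in> borel_measurable N"
  unfolding half_level_def by (intro borel_measurable_SUP countable_rat) measurable

lemma nonsingular_inverse:
  assumes S: "nonsingular N S" and S'[measurable]: "S' \<in> measurable N N"
    and inv: "\<And>y. y \<in> space N \<Longrightarrow> S' (S y) = y \<and> S (S' y) = y"
  shows "nonsingular N S'"
  unfolding nonsingular_def
proof (intro conjI ballI S')
  note Sm[measurable] = nonsingular_measurable[OF S]
  fix A assume A[measurable]: "A \<in> sets N"
  have "S -` (S' -` A \<inter> space N) \<inter> space N = A"
    using inv sets.sets_into_space[OF A] measurable_space[OF Sm] by auto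
  moreover have "S' -` A \<inter> space N \<in> sets N" by measurable
  ultimately show "emeasure N (S' -` A \<inter> space N) = 0 \<longleftrightarrow> emeasure N A = 0"
    using S unfolding nonsingular_def by metis
qed

text \<open>
  The half levels \<open>q y\<close> of the fibre densities \<open>f (\<cdot>, y)\<close> are compared along \<open>S\<close>. With \<open>w\<close> the
  density of the image of \<open>\<nu>\<close> under \<open>S\<close>, the level \<open>q\<close> on a fibre becomes the level
  \<open>q' y = w y * q (S\<^sup>-\<^sup>1 y)\<close> on the next one. Invariance of \<open>\<eta>\<close> shows that truncation at these
  transported levels loses no more mass than truncation at the original ones, so each \<open>q' y\<close> is
  reached by the truncated mean and \<open>q' \<le> q\<close> by maximality of \<open>q\<close>. This says that the measure
  with density \<open>q\<close> does not increase under preimages.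
\<close>

theorem equivalent_invariant_measure_of_factor:
  assumes "prob_space M" and "prob_space N"
    and T: "measure_preserving M T"
    and S: "nonsingular N S" and c: "conservative N S" and inv: "invertible_transformation N S"
    and sets_eta[measurable_cong]: "sets \<eta> = sets (M \<Otimes>\<^sub>M N)" and "sigma_finite_measure \<eta>"
    and ac: "absolutely_continuous (M \<Otimes>\<^sub>M N) \<eta>" and ac': "absolutely_continuous \<eta> (M \<Otimes>\<^sub>M N)"
    and mp: "measure_preserving \<eta> (map_prod T S)"
  shows "\<exists>\<kappa>. sets \<kappa> = sets N \<and> sigma_finite_measure \<kappa> \<and>
    absolutely_continuous N \<kappa> \<and> absolutely_continuous \<kappa> N \<and> measure_preserving \<kappa> S"
proof -
  interpret M: prob_space M by fact
  interpret N: prob_space N by fact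
  interpret pair_prob_space M N ..
  interpret E: sigma_finite_measure \<eta> by fact
  let ?P = "M \<Otimes>\<^sub>M N" and ?R = "map_prod T S"
  have Tm[measurable]: "T \<in> measurable M M" using T by (simp add: measure_preserving_def)
  note Sm[measurable] = nonsingular_measurable[OF S]
  obtain S' where S'm[measurable]: "S' \<in> measurable N N"
    and S': "\<And>y. y \<in> space N \<Longrightarrow> S' (S y) = y \<and> S (S' y) = y"
    using inv by (auto simp: invertible_transformation_def)
  have Rm[measurable]: "?R \<in> measurable ?P ?P" by (rule map_prod_measurable[OF Tm Sm])

  define f where "f = RN_deriv ?P \<eta>"
  have f[measurable]: "f \<in> borel_measurable ?P" unfolding f_def by measurable
  have dens: "density ?P f = \<eta>"
    unfolding f_def by (rule density_RN_deriv[OF ac sets_eta])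
  have eta: "emeasure \<eta> A = (\<integral>\<^sup>+z. f z * indicator A z \<partial>?P)" if "A \<in> sets ?P" for A
    using that by (simp add: dens[symmetric] emeasure_density)
  have "AE z in ?P. f z \<noteq> \<infinity>"
    unfolding f_def by (rule RN_deriv_finite[OF \<open>sigma_finite_measure \<eta>\<close> ac sets_eta])
  moreover have "AE z in ?P. f z \<noteq> 0"
  proof -
    have "emeasure \<eta> {z \<in> space ?P. f z = 0} = 0"
      by (subst eta) (auto intro!: nn_integral_zero' simp: indicator_def)
    then have "{z \<in> space ?P. f z = 0} \<in> null_sets \<eta>"
      by (intro null_setsI) measurable
    then have "{z \<in> space ?P. f z = 0} \<in> null_sets ?P"
      using ac' by (auto simp: absolutely_continuous_def)
    then show ?thesis by (rule AE_I') auto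
  qed
  ultimately have "AE z in ?P. 0 < f z \<and> f z < \<top>"
    by eventually_elim (auto simp: less_top zero_less_iff_neq_zero)
  then have "AE x in M. AE y in N. 0 < f (x, y) \<and> f (x, y) < \<top>"
    by (rule AE_pair)
  then have fpos: "AE y in N. AE x in M. 0 < f (x, y) \<and> f (x, y) < \<top>"
    by (subst (asm) AE_commute) auto

  define q where "q y = half_level M (\<lambda>x. f (x, y))" for y
  have q[measurable]: "q \<in> borel_measurable N"
    using M.borel_measurable_half_level[of "\<lambda>(y, x). f (x, y)" N] by (simp add: q_def[abs_def])
  have q_fin: "AE y in N. 0 < q y \<and> q y < \<top>"
    using fpos AE_space
  proof eventually_elim
    case (elim y)
    then have "(\<lambda>x. f (x, y)) \<in> borel_measurable M" by measurable
    then show ?case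
      using elim unfolding q_def by (intro conjI M.half_level_pos M.half_level_finite) (auto elim: eventually_mono)
  qed

  define w where "w = RN_deriv N (distr N N S)"
  have w[measurable]: "w \<in> borel_measurable N" unfolding w_def by measurable
  have acS: "absolutely_continuous N (distr N N S)"
    using S by (auto simp: absolutely_continuous_def null_sets_def nonsingular_def emeasure_distr)
  have wS: "(\<integral>\<^sup>+y. h (S y) \<partial>N) = (\<integral>\<^sup>+y. w y * h y \<partial>N)" if [measurable]: "h \<in> borel_measurable N" for h
  proof -
    have "(\<integral>\<^sup>+y. h (S y) \<partial>N) = (\<integral>\<^sup>+y. h y \<partial>distr N N S)" by (rule nn_integral_distr[symmetric]) measurable
    also have "distr N N S = density N w"
      unfolding w_def by (rule N.density_RN_deriv[symmetric]) (use acS in auto)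
    also have "(\<integral>\<^sup>+y. h y \<partial>density N w) = (\<integral>\<^sup>+y. w y * h y \<partial>N)" by (rule nn_integral_density) measurable
    finally show ?thesis .
  qed
  have w_fin: "AE y in N. w y \<noteq> \<infinity>"
    unfolding w_def
    by (rule N.RN_deriv_finite) (use acS in \<open>auto intro!: prob_space_imp_sigma_finite N.prob_space_distr\<close>)

  define q' where "q' y = w y * q (S' y)" for y
  have q'[measurable]: "q' \<in> borel_measurable N" unfolding q'_def by measurable
  have nsS': "nonsingular N S'"
    by (rule nonsingular_inverse[OF S S'm]) (use S' in \<open>auto\<close>)
  have q'_fin: "AE y in N. q' y < \<top>"
    using w_fin nonsingular_AE[OF nsS' q_fin]
    by eventually_elim (auto simp: q'_def ennreal_mult_less_top less_top)
  have q'_int: "(\<integral>\<^sup>+y. q' y * indicator B y \<partial>N) = (\<integral>\<^sup>+y. q y * indicator B (S y) \<partial>N)"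
    if [measurable]: "B \<in> sets N" for B
  proof -
    have "(\<integral>\<^sup>+y. q' y * indicator B y \<partial>N) = (\<integral>\<^sup>+y. w y * (q (S' y) * indicator B y) \<partial>N)"
      by (simp add: q'_def mult.assoc)
    also have "\<dots> = (\<integral>\<^sup>+y. q (S' (S y)) * indicator B (S y) \<partial>N)"
      by (rule wS[symmetric]) measurable
    also have "\<dots> = (\<integral>\<^sup>+y. q y * indicator B (S y) \<partial>N)"
      using S' by (intro nn_integral_cong) auto
    finally show ?thesis .
  qed
  have Tint: "(\<integral>\<^sup>+x. h (T x) \<partial>M) = (\<integral>\<^sup>+x. h x \<partial>M)" if [measurable]: "h \<in> borel_measurable M" for h
  proof -
    have "distr M M T = M"
      using T by (intro measure_eqI) (auto simp: emeasure_distr measure_preserving_def)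
    moreover have "(\<integral>\<^sup>+x. h (T x) \<partial>M) = (\<integral>\<^sup>+x. h x \<partial>distr M M T)"
      by (rule nn_integral_distr[symmetric]) measurable
    ultimately show ?thesis by simp
  qed

  let ?\<Phi> = "\<lambda>a y. \<integral>\<^sup>+x. min (f (x, y)) (a y) \<partial>M"
  have key: "(\<integral>\<^sup>+y. ?\<Phi> q y * indicator B (S y) \<partial>N) \<le> (\<integral>\<^sup>+y. ?\<Phi> q' y * indicator B y \<partial>N)"
    if [measurable]: "B \<in> sets N" for B
  proof -
    \<comment> \<open>The truncated integral of \<open>f\<close> over the fibres above the preimage of \<open>B\<close> is estimated by \<open>f\<close> on
      the preimage of \<open>C\<close> and by the level \<open>q\<close> on the preimage of \<open>C'\<close>. This splitting is optimal after
      \<open>R\<close> is applied: there \<open>C\<close> is where \<open>f\<close> is the smaller of the two.\<close>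
    define C where "C = {z \<in> space ?P. snd z \<in> B \<and> f z \<le> q' (snd z)}"
    define C' where "C' = {z \<in> space ?P. snd z \<in> B \<and> \<not> f z \<le> q' (snd z)}"
    have C[measurable]: "C \<in> sets ?P" "C' \<in> sets ?P" unfolding C_def C'_def by measurable
    let ?h = "\<lambda>z. q (S' (snd z)) * indicator C' z"
    have "(\<integral>\<^sup>+y. ?\<Phi> q y * indicator B (S y) \<partial>N) = (\<integral>\<^sup>+y. \<integral>\<^sup>+x. min (f (x, y)) (q y) * indicator B (S y) \<partial>M \<partial>N)"
      by (intro nn_integral_cong nn_integral_multc[symmetric]) measurable
    also have "\<dots> \<le> (\<integral>\<^sup>+y. \<integral>\<^sup>+x. f (x, y) * indicator (?R -` C \<inter> space ?P) (x, y) + ?h (T x, S y) \<partial>M \<partial>N)"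
      using measurable_space[OF Tm] measurable_space[OF Sm] S'
      by (intro nn_integral_mono) (auto simp: indicator_def C_def C'_def space_pair_measure)
    also have "\<dots> = (\<integral>\<^sup>+y. (\<integral>\<^sup>+x. f (x, y) * indicator (?R -` C \<inter> space ?P) (x, y) \<partial>M) + (\<integral>\<^sup>+x. ?h (T x, S y) \<partial>M) \<partial>N)"
      by (intro nn_integral_cong nn_integral_add) measurable
    also have "\<dots> = (\<integral>\<^sup>+y. \<integral>\<^sup>+x. f (x, y) * indicator (?R -` C \<inter> space ?P) (x, y) \<partial>M \<partial>N) + (\<integral>\<^sup>+y. \<integral>\<^sup>+x. ?h (T x, S y) \<partial>M \<partial>N)"
      by (intro nn_integral_add) measurable
    also have "(\<integral>\<^sup>+y. \<integral>\<^sup>+x. f (x, y) * indicator (?R -` C \<inter> space ?P) (x, y) \<partial>M \<partial>N) = emeasure \<eta> (?R -` C \<inter> space ?P)"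
      by (subst eta) (auto intro!: nn_integral_snd[of "\<lambda>z. f z * indicator (?R -` C \<inter> space ?P) z"])
    also have "\<dots> = emeasure \<eta> C"
      using mp C sets_eq_imp_space_eq[OF sets_eta] by (auto simp: measure_preserving_def sets_eta)
    also have "\<dots> = (\<integral>\<^sup>+y. \<integral>\<^sup>+x. f (x, y) * indicator C (x, y) \<partial>M \<partial>N)"
      by (subst eta) (auto intro!: nn_integral_snd[of "\<lambda>z. f z * indicator C z", symmetric])
    also have "(\<integral>\<^sup>+y. \<integral>\<^sup>+x. ?h (T x, S y) \<partial>M \<partial>N) = (\<integral>\<^sup>+y. \<integral>\<^sup>+x. ?h (x, S y) \<partial>M \<partial>N)"
      by (intro nn_integral_cong Tint[of "\<lambda>x. ?h (x, S _)"]) measurable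
    also have "\<dots> = (\<integral>\<^sup>+y. w y * (\<integral>\<^sup>+x. ?h (x, y) \<partial>M) \<partial>N)"
      by (rule wS) measurable
    also have "\<dots> = (\<integral>\<^sup>+y. \<integral>\<^sup>+x. w y * ?h (x, y) \<partial>M \<partial>N)"
      by (intro nn_integral_cong nn_integral_cmult[symmetric]) measurable
    also have "(\<integral>\<^sup>+y. \<integral>\<^sup>+x. f (x, y) * indicator C (x, y) \<partial>M \<partial>N) + (\<integral>\<^sup>+y. \<integral>\<^sup>+x. w y * ?h (x, y) \<partial>M \<partial>N)
      = (\<integral>\<^sup>+y. (\<integral>\<^sup>+x. f (x, y) * indicator C (x, y) \<partial>M) + (\<integral>\<^sup>+x. w y * ?h (x, y) \<partial>M) \<partial>N)"
      by (rule nn_integral_add[symmetric]) measurable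
    also have "\<dots> = (\<integral>\<^sup>+y. \<integral>\<^sup>+x. f (x, y) * indicator C (x, y) + w y * ?h (x, y) \<partial>M \<partial>N)"
      by (intro nn_integral_cong nn_integral_add[symmetric]) measurable
    also have "\<dots> = (\<integral>\<^sup>+y. \<integral>\<^sup>+x. min (f (x, y)) (q' y) * indicator B y \<partial>M \<partial>N)"
      by (intro nn_integral_cong)
        (auto simp: C_def C'_def q'_def indicator_def space_pair_measure min_def)
    also have "\<dots> = (\<integral>\<^sup>+y. ?\<Phi> q' y * indicator B y \<partial>N)"
      by (intro nn_integral_cong nn_integral_multc) measurable
    finally show ?thesis .
  qed

  have "AE y in N. q' y \<le> 2 * ?\<Phi> q' y"
  proof (rule N.AE_le_if_nn_integral_le)
    show "AE y in N. 2 * ?\<Phi> q' y < \<top>"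
      using q'_fin
    proof eventually_elim
      case (elim y)
      have "?\<Phi> q' y \<le> (\<integral>\<^sup>+x. q' y \<partial>M)" by (intro nn_integral_mono) auto
      also have "\<dots> < \<top>" using elim by (simp add: M.emeasure_space_1)
      finally show ?case by (simp add: ennreal_mult_less_top)
    qed
    fix B assume B[measurable]: "B \<in> sets N"
    have "(\<integral>\<^sup>+y. q' y * indicator B y \<partial>N) = (\<integral>\<^sup>+y. q y * indicator B (S y) \<partial>N)" by (rule q'_int[OF B])
    also have "\<dots> \<le> (\<integral>\<^sup>+y. 2 * (?\<Phi> q y * indicator B (S y)) \<partial>N)"
      using half_level_le[of M "\<lambda>x. f (x, _)"]
      by (intro nn_integral_mono) (auto simp: q_def indicator_def)
    also have "\<dots> = 2 * (\<integral>\<^sup>+y. ?\<Phi> q y * indicator B (S y) \<partial>N)" by (rule nn_integral_cmult) measurable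
    also have "\<dots> \<le> 2 * (\<integral>\<^sup>+y. ?\<Phi> q' y * indicator B y \<partial>N)" by (intro mult_left_mono key B) auto
    also have "\<dots> = (\<integral>\<^sup>+y. 2 * (?\<Phi> q' y * indicator B y) \<partial>N)" by (rule nn_integral_cmult[symmetric]) measurable
    finally show "(\<integral>\<^sup>+y. q' y * indicator B y \<partial>N) \<le> (\<integral>\<^sup>+y. 2 * ?\<Phi> q' y * indicator B y \<partial>N)"
      by (simp add: mult.assoc)
  qed measurable
  with q'_fin have q'_le: "AE y in N. q' y \<le> q y"
    using AE_space
    by eventually_elim (auto simp: q_def intro!: half_level_greatest)

  define \<kappa> where "\<kappa> = density N q"
  have kappa: "emeasure \<kappa> B = (\<integral>\<^sup>+y. q y * indicator B y \<partial>N)" if "B \<in> sets N" for B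
    using that by (simp add: \<kappa>_def emeasure_density)
  have sets: "sets \<kappa> = sets N" by (simp add: \<kappa>_def)
  have sf: "sigma_finite_measure \<kappa>"
  proof -
    have "AE y in N. q y \<noteq> \<infinity>" using q_fin by eventually_elim auto
    then show ?thesis by (simp add: \<kappa>_def N.sigma_finite_iff_density_finite)
  qed
  have acN: "absolutely_continuous N \<kappa>"
    unfolding \<kappa>_def by (rule absolutely_continuousI_density) measurable
  have acK: "absolutely_continuous \<kappa> N"
  proof -
    have "A \<in> null_sets N" if "A \<in> null_sets \<kappa>" for A
    proof -
      have A: "A \<in> sets N" "AE y in N. y \<in> A \<longrightarrow> q y = 0"
        using that by (auto simp: \<kappa>_def null_sets_density_iff)
      from A(2) q_fin have "AE y in N. y \<notin> A" by eventually_elim auto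
      then show ?thesis using A(1) by (simp add: AE_iff_null_sets)
    qed
    then show ?thesis by (auto simp: absolutely_continuous_def)
  qed
  have "measure_preserving \<kappa> S"
  proof (rule conservative_subinvariant_imp_measure_preserving[OF S c sets sf acN])
    fix B assume B[measurable]: "B \<in> sets N"
    have "emeasure \<kappa> (S -` B \<inter> space N) = (\<integral>\<^sup>+y. q y * indicator B (S y) \<partial>N)"
      by (subst kappa) (auto intro!: nn_integral_cong simp: indicator_def)
    also have "\<dots> = (\<integral>\<^sup>+y. q' y * indicator B y \<partial>N)" by (rule q'_int[OF B, symmetric])
    also have "\<dots> \<le> (\<integral>\<^sup>+y. q y * indicator B y \<partial>N)"
      using q'_le by (intro nn_integral_mono_AE) (auto elim!: eventually_mono simp: indicator_def)
    also have "\<dots> = emeasure \<kappa> B" by (rule kappa[OF B, symmetric])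
    finally show "emeasure \<kappa> (S -` B \<inter> space N) \<le> emeasure \<kappa> B" .
  qed
  with sets sf acN acK show ?thesis by blast
qed

theorem type_III_map_prod:
  assumes "prob_space M" and "prob_space N"
    and T: "measure_preserving M T"
    and III: "type_III N S" and c: "conservative N S" and inv: "invertible_transformation N S"
  shows "type_III (M \<Otimes>\<^sub>M N) (map_prod T S)"
proof -
  interpret M: prob_space M by fact
  interpret N: prob_space N by fact
  have S: "nonsingular N S" using III by (simp add: type_III_def)
  have "nonsingular (M \<Otimes>\<^sub>M N) (map_prod T S)"
    by (intro nonsingular_map_prod T S) unfold_locales
  then show ?thesis
    using equivalent_invariant_measure_of_factor[OF assms(1,2) T S c inv] III unfolding type_III_def by blast
qed

theorem corollary4p4:
  fixes M :: "'a measure" and dX :: "'a \<Rightarrow> 'a \<Rightarrow> real" and T :: "'a \<Rightarrow> 'a"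
    and N :: "'b measure" and dY :: "'b \<Rightarrow> 'b \<Rightarrow> real" and S :: "'b \<Rightarrow> 'b"
  assumes "standard_prob_space M" and "measurable_metric M dX"
    and "measure_preserving M T" and "mixing M T \<or> mildly_mixing M T"
    and "restricted_sensitive M dX T"
    and "standard_prob_space N" and "measurable_metric N dY" and "ae_positive_balls N dY"
    and "nonsingular N S" and "invertible_transformation N S"
    and "type_III N S" and "conservative N S" and "ergodic N S"
  shows "type_III (M \<Otimes>\<^sub>M N) (map_prod T S) \<and>
    conservative (M \<Otimes>\<^sub>M N) (map_prod T S) \<and>
    ergodic (M \<Otimes>\<^sub>M N) (map_prod T S) \<and>
    restricted_sensitive (M \<Otimes>\<^sub>M N)
      (\<lambda>(x1, y1) (x2, y2). max (dX x1 x2) (dY y1 y2)) (map_prod T S)"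
proof -
  have pM: "prob_space M" and pN: "prob_space N"
    using assms(1,6) by (simp_all add: standard_prob_space_def)
  interpret M: prob_space M by fact
  interpret N: prob_space N by fact
  have "mildly_mixing M T"
    using assms(4) M.mixing_imp_mildly_mixing[OF assms(3)] by blast
  moreover have "nonsingular (M \<Otimes>\<^sub>M N) (map_prod T S)"
    by (intro nonsingular_map_prod assms(3,9)) unfold_locales
  ultimately show ?thesis
    using type_III_map_prod[OF pM pN assms(3,11,12,10)]
      conservative_map_prod[OF pM N.sigma_finite_measure_axioms assms(3,9,12)]
      ergodic_map_prod[OF pM N.sigma_finite_measure_axioms assms(3) _ assms(9,12,13)]
      restricted_sensitive_map_prod[OF assms(5) pN assms(7,8) _ assms(9)]
    by blast
qed

end
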